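(* Let $\mathbb{K}\in\{\mathbb{R},\mathbb{C}\}$, let $H$ be a separable infinite-dimensional Hilbert space over $\mathbb{K}$, and let $A:\operatorname{dom}(A)\to H$ be a densely-defined symmetric operator on $H$. Then there exist a compact metric space $(\Omega,d)$ endowed with a probability measure $\mu$ on its Borel $\sigma$-algebra, a Borel measurable function $m:\Omega\rightarrow\mathbb{R}$ generating the self-adjoint multiplication operator $T$ on $L_2(\Omega,\mu)$, and an isometry $U:H\rightarrow L_2(\Omega,\mu)$ such that $T\circ U$ extends $U\circ A$.
   Context: $L_2(\Omega,\mu)$ is the Hilbert space of $\mathbb{K}$-valued square-integrable functions (modulo a.e. equality). The multiplication operator $T$ generated by $m$ has domain $\{g\in L_2(\Omega,\mu) : mg\in L_2(\Omega,\mu)\}$ and $Tg=mg$. An isometry between Hilbert spaces is a linear norm-preserving map, not necessarily surjective. $A$ is not assumed bounded or self-adjoint. "$T\circ U$ extends $U\circ A$" means that for every $x\in\operatorname{dom}(A)$ one has $Ux\in\operatorname{dom}(T)$ and $T(Ux)=U(Ax)$. *)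

theory Defs
  imports "HOL-Probability.Probability"
begin

text \<open>
  The scalar field K, which is the field of real or the field of complex numbers. A type of this
  class is identified by \<open>to_complex\<close>, an isometric embedding of unital real algebras, with one of
  these two subfields of the complex numbers. The types \<open>real\<close> and \<open>complex\<close> are instances.
\<close>

class rc_scalar = real_normed_field + banach + second_countable_topology +
  fixes to_complex :: "'a \<Rightarrow> complex"
    and rc_cnj :: "'a \<Rightarrow> 'a"
  assumes to_complex_add: "to_complex (a + b) = to_complex a + to_complex b"
    and to_complex_mult: "to_complex (a * b) = to_complex a * to_complex b"
    and to_complex_one: "to_complex 1 = 1"
    and to_complex_scaleR: "to_complex (r *\<^sub>R a) = r *\<^sub>R to_complex a"
    and norm_to_complex: "norm (to_complex a) = norm a"
    and range_to_complex: "range to_complex = \<real> \<or> range to_complex = UNIV"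
    and to_complex_rc_cnj: "to_complex (rc_cnj a) = cnj (to_complex a)"

instantiation real :: rc_scalar
begin

definition to_complex_real :: "real \<Rightarrow> complex" where "to_complex_real = complex_of_real"

definition rc_cnj_real :: "real \<Rightarrow> real" where "rc_cnj_real a = a"

instance
  by standard (auto simp: to_complex_real_def rc_cnj_real_def Reals_def scaleR_conv_of_real)

end

instantiation complex :: rc_scalar
begin

definition to_complex_complex :: "complex \<Rightarrow> complex" where "to_complex_complex a = a"

definition rc_cnj_complex :: "complex \<Rightarrow> complex" where "rc_cnj_complex = cnj"

instance
  by standard (auto simp: to_complex_complex_def rc_cnj_complex_def)

end

text \<open>
  A Hilbert space over K is a Banach space with a compatible multiplication by scalars from K and
  an inner product that induces the norm. The inner product is linear in the first argument.
\<close>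

locale rc_hilbert = vector_space smul
  for smul :: "'k::rc_scalar \<Rightarrow> 'h::banach \<Rightarrow> 'h" +
  fixes ip :: "'h \<Rightarrow> 'h \<Rightarrow> 'k"
  assumes smul_of_real: "smul (of_real r) x = r *\<^sub>R x"
    and ip_add_left: "ip (x + y) z = ip x z + ip y z"
    and ip_smul_left: "ip (smul c x) y = c * ip x y"
    and ip_commute: "ip y x = rc_cnj (ip x y)"
    and ip_self: "ip x x = of_real ((norm x)\<^sup>2)"

definition infinite_dimensional :: "('k::field \<Rightarrow> 'h::ab_group_add \<Rightarrow> 'h) \<Rightarrow> bool"
  where "infinite_dimensional smul \<longleftrightarrow> \<not> (\<exists>B. finite B \<and> module.span smul B = UNIV)"

text \<open>An operator is given by its domain \<open>D\<close> and a function \<open>A\<close>, whose values outside of \<open>D\<close> are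
  irrelevant.\<close>

definition linear_operator :: "('k::field \<Rightarrow> 'h::ab_group_add \<Rightarrow> 'h) \<Rightarrow> 'h set \<Rightarrow> ('h \<Rightarrow> 'h) \<Rightarrow> bool"
  where "linear_operator smul D A \<longleftrightarrow>
    module.subspace smul D \<and>
    (\<forall>x\<in>D. \<forall>y\<in>D. A (x + y) = A x + A y) \<and>
    (\<forall>c. \<forall>x\<in>D. A (smul c x) = smul c (A x))"

definition densely_defined :: "'h::topological_space set \<Rightarrow> bool"
  where "densely_defined D \<longleftrightarrow> closure D = UNIV"

definition symmetric_operator :: "('h \<Rightarrow> 'h \<Rightarrow> 'k) \<Rightarrow> 'h set \<Rightarrow> ('h \<Rightarrow> 'h) \<Rightarrow> bool"
  where "symmetric_operator ip D A \<longleftrightarrow> (\<forall>x\<in>D. \<forall>y\<in>D. ip (A x) y = ip x (A y))"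

text \<open>
  The Hilbert space of square-integrable K-valued functions, whose elements are classes of
  functions modulo equality almost everywhere. The operations on classes are computed on
  representatives; by \<open>L2_class_eq_iff\<close> and \<open>AE_L2_rep_class\<close> the choice is immaterial.
\<close>

definition square_integrable :: "'a measure \<Rightarrow> ('a \<Rightarrow> 'k::rc_scalar) set"
  where "square_integrable M =
    {f \<in> borel_measurable M. integrable M (\<lambda>x. (norm (f x))\<^sup>2)}"

definition ae_eq_rel :: "'a measure \<Rightarrow> (('a \<Rightarrow> 'k::rc_scalar) \<times> ('a \<Rightarrow> 'k)) set"
  where "ae_eq_rel M =
    {(f, g). f \<in> square_integrable M \<and> g \<in> square_integrable M \<and> (AE x in M. f x = g x)}"

definition L2 :: "'a measure \<Rightarrow> ('a \<Rightarrow> 'k::rc_scalar) set set"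
  where "L2 M = square_integrable M // ae_eq_rel M"

definition L2_class :: "'a measure \<Rightarrow> ('a \<Rightarrow> 'k::rc_scalar) \<Rightarrow> ('a \<Rightarrow> 'k) set"
  where "L2_class M f = ae_eq_rel M `` {f}"

definition L2_rep :: "('a \<Rightarrow> 'k) set \<Rightarrow> 'a \<Rightarrow> 'k"
  where "L2_rep F = (SOME f. f \<in> F)"

lemma equiv_ae_eq_rel: "equiv (square_integrable M) (ae_eq_rel M)"
proof (rule equivI)
  show "ae_eq_rel M \<subseteq> square_integrable M \<times> square_integrable M"
    by (auto simp: ae_eq_rel_def)
  show "refl_on (square_integrable M) (ae_eq_rel M)"
    by (auto simp: refl_on_def ae_eq_rel_def)
  show "sym (ae_eq_rel M)"
    by (auto simp: sym_def ae_eq_rel_def eq_commute)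
  show "trans (ae_eq_rel M)"
    unfolding trans_def ae_eq_rel_def by auto
qed

lemma L2_class_eq_iff:
  assumes "f \<in> square_integrable M" "g \<in> square_integrable M"
  shows "L2_class M f = L2_class M g \<longleftrightarrow> (AE x in M. f x = g x)"
  using eq_equiv_class_iff[OF equiv_ae_eq_rel assms] assms
  by (simp add: L2_class_def ae_eq_rel_def)

lemma L2_rep_in:
  assumes "F \<in> L2 M"
  shows "L2_rep F \<in> F"
  using in_quotient_imp_non_empty[OF equiv_ae_eq_rel assms[unfolded L2_def]]
  by (simp add: L2_rep_def some_in_eq)

lemma L2_rep_square_integrable: "F \<in> L2 M \<Longrightarrow> L2_rep F \<in> square_integrable M"
  using L2_rep_in in_quotient_imp_subset[OF equiv_ae_eq_rel] unfolding L2_def by blast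

lemma AE_L2_rep_class:
  assumes "f \<in> square_integrable M"
  shows "AE x in M. L2_rep (L2_class M f) x = f x"
proof -
  have "L2_class M f \<in> L2 M"
    using assms by (auto simp: L2_def L2_class_def intro: quotientI)
  from L2_rep_in[OF this] show ?thesis
    by (auto simp: L2_class_def ae_eq_rel_def eq_commute)
qed

definition L2_add :: "'a measure \<Rightarrow> ('a \<Rightarrow> 'k::rc_scalar) set \<Rightarrow> ('a \<Rightarrow> 'k) set \<Rightarrow> ('a \<Rightarrow> 'k) set"
  where "L2_add M F G = L2_class M (\<lambda>x. L2_rep F x + L2_rep G x)"

definition L2_diff :: "'a measure \<Rightarrow> ('a \<Rightarrow> 'k::rc_scalar) set \<Rightarrow> ('a \<Rightarrow> 'k) set \<Rightarrow> ('a \<Rightarrow> 'k) set"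
  where "L2_diff M F G = L2_class M (\<lambda>x. L2_rep F x - L2_rep G x)"

definition L2_scale :: "'a measure \<Rightarrow> 'k::rc_scalar \<Rightarrow> ('a \<Rightarrow> 'k) set \<Rightarrow> ('a \<Rightarrow> 'k) set"
  where "L2_scale M c F = L2_class M (\<lambda>x. c * L2_rep F x)"

definition L2_inner :: "'a measure \<Rightarrow> ('a \<Rightarrow> 'k::rc_scalar) set \<Rightarrow> ('a \<Rightarrow> 'k) set \<Rightarrow> 'k"
  where "L2_inner M F G = (\<integral>x. L2_rep F x * rc_cnj (L2_rep G x) \<partial>M)"

definition L2_norm :: "'a measure \<Rightarrow> ('a \<Rightarrow> 'k::rc_scalar) set \<Rightarrow> real"
  where "L2_norm M F = sqrt (\<integral>x. (norm (L2_rep F x))\<^sup>2 \<partial>M)"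

definition mult_dom :: "'a measure \<Rightarrow> ('a \<Rightarrow> real) \<Rightarrow> ('a \<Rightarrow> 'k::rc_scalar) set set"
  where "mult_dom M m = {F \<in> L2 M. (\<lambda>x. of_real (m x) * L2_rep F x) \<in> square_integrable M}"

definition mult_op :: "'a measure \<Rightarrow> ('a \<Rightarrow> real) \<Rightarrow> ('a \<Rightarrow> 'k::rc_scalar) set \<Rightarrow> ('a \<Rightarrow> 'k) set"
  where "mult_op M m F = L2_class M (\<lambda>x. of_real (m x) * L2_rep F x)"

definition L2_dense :: "'a measure \<Rightarrow> ('a \<Rightarrow> 'k::rc_scalar) set set \<Rightarrow> bool"
  where "L2_dense M D \<longleftrightarrow>
    D \<subseteq> L2 M \<and> (\<forall>F\<in>L2 M. \<forall>e>0. \<exists>G\<in>D. L2_norm M (L2_diff M F G) < e)"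

text \<open>The graph of the adjoint of the operator \<open>T\<close> with domain \<open>D\<close>, which is single-valued if \<open>D\<close>
  is dense.\<close>

definition L2_adjoint_graph ::
  "'a measure \<Rightarrow> ('a \<Rightarrow> 'k::rc_scalar) set set \<Rightarrow> (('a \<Rightarrow> 'k) set \<Rightarrow> ('a \<Rightarrow> 'k) set)
    \<Rightarrow> (('a \<Rightarrow> 'k) set \<times> ('a \<Rightarrow> 'k) set) set"
  where "L2_adjoint_graph M D T =
    {(G, H). G \<in> L2 M \<and> H \<in> L2 M \<and> (\<forall>F\<in>D. L2_inner M (T F) G = L2_inner M F H)}"

definition L2_self_adjoint ::
  "'a measure \<Rightarrow> ('a \<Rightarrow> 'k::rc_scalar) set set \<Rightarrow> (('a \<Rightarrow> 'k) set \<Rightarrow> ('a \<Rightarrow> 'k) set) \<Rightarrow> bool"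
  where "L2_self_adjoint M D T \<longleftrightarrow>
    L2_dense M D \<and> L2_adjoint_graph M D T = {(F, T F) | F. F \<in> D}"

definition isometry_into_L2 ::
  "('k::rc_scalar \<Rightarrow> 'h::real_normed_vector \<Rightarrow> 'h) \<Rightarrow> 'a measure \<Rightarrow> ('h \<Rightarrow> ('a \<Rightarrow> 'k) set) \<Rightarrow> bool"
  where "isometry_into_L2 smul M U \<longleftrightarrow>
    (\<forall>x. U x \<in> L2 M) \<and>
    (\<forall>x y. U (x + y) = L2_add M (U x) (U y)) \<and>
    (\<forall>c x. U (smul c x) = L2_scale M c (U x)) \<and>
    (\<forall>x. L2_norm M (U x) = norm x)"

definition compact_metric_space :: "'a set \<Rightarrow> ('a \<Rightarrow> 'a \<Rightarrow> real) \<Rightarrow> bool"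
  where "compact_metric_space \<Omega> d \<longleftrightarrow>
    Metric_space \<Omega> d \<and> compact_space (Metric_space.mtopology \<Omega> d)"

definition borel_probability :: "'a set \<Rightarrow> ('a \<Rightarrow> 'a \<Rightarrow> real) \<Rightarrow> 'a measure \<Rightarrow> bool"
  where "borel_probability \<Omega> d M \<longleftrightarrow>
    space M = \<Omega> \<and> sets M = sigma_sets \<Omega> {S. openin (Metric_space.mtopology \<Omega> d) S} \<and>
    prob_space M"

text \<open>
  The points of the compact metric spaces asserted to exist are taken from this type. Since a
  compact metric space has at most the cardinality of the continuum, every such space is isometric
  to one whose points are sequences of reals.
\<close>

type_synonym point = "nat \<Rightarrow> real"

end

theory Submission
  imports Defs
begin

text \<open>
  No spectral theorem for unbounded operators is needed. By taking real parts of the inner product,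
  consider \<open>H\<close> as a real Hilbert space. Choose a sequence \<open>e\<^sub>k\<close> in the domain such that the pairs
  \<open>(e\<^sub>k, A e\<^sub>k)\<close> are dense in the graph of \<open>A\<close>. The compression of \<open>A\<close> to the span of
  \<open>e\<^sub>0, \<dots>, e\<^sub>n\<^sub>-\<^sub>1\<close> has an orthonormal eigenbasis \<open>T\<^sub>n\<close>, and on \<open>T\<^sub>n\<close> the functions
  \<open>t \<mapsto> \<langle>e\<^sub>k, t\<rangle>\<close> and \<open>t \<mapsto> \<langle>A e\<^sub>k, t\<rangle>\<close> represent the compression as multiplication by the
  eigenvalues. Passing to a density with respect to the weight
  \<open>w(t) = \<Sum>\<^sub>k c\<^sub>k (\<langle>e\<^sub>k, t\<rangle>\<^sup>2 + \<langle>A e\<^sub>k, t\<rangle>\<^sup>2)\<close> makes all these functions bounded, uniformly in \<open>n\<close>. Their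
  joint laws thus live on one Hilbert cube, which is a continuous image of \<open>[0, 1]\<close>, so by Helly's
  selection theorem they have a weak limit \<open>\<mu>\<close> along a subsequence. In the limit there are functions
  \<open>h\<^sub>k, g\<^sub>k\<close> with the Gram matrix of the \<open>e\<^sub>k, A e\<^sub>k\<close> and with \<open>g\<^sub>j h\<^sub>k = g\<^sub>k h\<^sub>j\<close>. Hence \<open>e\<^sub>k \<mapsto> h\<^sub>k\<close>
  extends to an isometry that maps \<open>A e\<^sub>k\<close> to \<open>g\<^sub>k\<close>, and \<open>m = g\<^sub>k / h\<^sub>k\<close> is well-defined wherever
  some \<open>h\<^sub>k\<close> does not vanish; elsewhere the whole range of the isometry vanishes. If the scalars are
  complex, \<open>x \<mapsto> (F x - \<i> F (\<i> x)) / \<surd>2\<close> turns the real isometry \<open>F\<close> into a complex linear one.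
\<close>

subsection \<open>Coding the Hilbert cube by the unit interval\<close>

text \<open>
  On the ternary Cantor set \<open>clamp_bit\<close> reads off the first digit (\<open>2\<close> as \<open>1\<close>) and \<open>ternary_shift\<close>
  drops it, but both are continuous on the whole line.
\<close>

definition clamp_bit :: "real \<Rightarrow> real"
  where "clamp_bit t = max 0 (min 1 (3 * t - 1))"

definition ternary_shift :: "real \<Rightarrow> real"
  where "ternary_shift t = 3 * t - 2 * clamp_bit t"

definition cantor_bit :: "nat \<Rightarrow> real \<Rightarrow> real"
  where "cantor_bit i t = clamp_bit ((ternary_shift ^^ i) t)"

definition cantor_point :: "(nat \<Rightarrow> bool) \<Rightarrow> real"
  where "cantor_point b = (\<Sum>i. 2 * of_bool (b i) * (1 / 3) ^ Suc i)"

lemma cantor_bit_bounds: "0 \<le> cantor_bit i t" "cantor_bit i t \<le> 1"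
  by (auto simp: cantor_bit_def clamp_bit_def)

lemma continuous_on_cantor_bit: "continuous_on A (cantor_bit i)"
proof -
  have c: "continuous_on UNIV clamp_bit"
    unfolding clamp_bit_def by (intro continuous_intros)
  have s: "continuous_on UNIV ternary_shift"
    unfolding ternary_shift_def by (intro continuous_intros c)
  have "continuous_on UNIV (ternary_shift ^^ i)"
  proof (induction i)
    case (Suc i)
    then show ?case
      using continuous_on_compose[OF Suc continuous_on_subset[OF s]] by simp
  qed (simp add: id_def)
  then have "continuous_on UNIV (clamp_bit \<circ> (ternary_shift ^^ i))"
    by (rule continuous_on_compose) (rule continuous_on_subset[OF c], simp)
  then have "continuous_on UNIV (cantor_bit i)"
    by (simp add: comp_def cantor_bit_def[abs_def])
  then show ?thesis
    by (rule continuous_on_subset) simp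
qed

lemma summable_cantor: "summable (\<lambda>i. 2 * of_bool (b i) * (1 / 3 :: real) ^ Suc i)"
proof (rule summable_comparison_test')
  show "summable (\<lambda>i. 2 * (1 / 3 :: real) ^ Suc i)"
    by (intro summable_mult) (subst summable_Suc_iff, simp add: summable_geometric)
qed auto

lemma cantor_point_bounds: "0 \<le> cantor_point b" "cantor_point b \<le> 1"
proof -
  show "0 \<le> cantor_point b"
    unfolding cantor_point_def by (intro suminf_nonneg summable_cantor) auto
  have *: "(\<lambda>i. 2 * (1 / 3 :: real) ^ Suc i) sums 1"
    using sums_mult[OF geometric_sums[of "1/3 :: real"], of "2/3"] by simp
  have "cantor_point b \<le> (\<Sum>i. 2 * (1 / 3 :: real) ^ Suc i)"
    unfolding cantor_point_def
    by (intro suminf_le summable_cantor sums_summable[OF *]) auto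
  then show "cantor_point b \<le> 1"
    using sums_unique[OF *] by simp
qed

lemma cantor_point_tail:
  "cantor_point b = (2 * of_bool (b 0) + cantor_point (\<lambda>i. b (Suc i))) / 3"
proof -
  have "cantor_point b
      = 2 * of_bool (b 0) / 3 + (\<Sum>i. 2 * of_bool (b (Suc i)) * (1 / 3) ^ Suc (Suc i))"
    unfolding cantor_point_def using suminf_split_head[OF summable_cantor[of b]] by simp
  also have "(\<Sum>i. 2 * of_bool (b (Suc i)) * (1 / 3) ^ Suc (Suc i))
      = (\<Sum>i. (1 / 3 :: real) * (2 * of_bool (b (Suc i)) * (1 / 3) ^ Suc i))"
    by (simp add: mult_ac)
  also have "\<dots> = cantor_point (\<lambda>i. b (Suc i)) / 3"
    unfolding cantor_point_def by (subst suminf_mult[OF summable_cantor]) simp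
  finally show ?thesis by simp
qed

text \<open>A leading digit 0 puts the point into [0, 1/3] and a leading digit 2 into [2/3, 1]; the
  ramp \<open>clamp_bit\<close> is constant on either interval.\<close>

lemma clamp_bit_cantor_point: "clamp_bit (cantor_point b) = of_bool (b 0)"
  using cantor_point_tail[of b] cantor_point_bounds[of "\<lambda>i. b (Suc i)"]
  by (cases "b 0") (auto simp: clamp_bit_def)

lemma ternary_shift_cantor_point:
  "ternary_shift (cantor_point b) = cantor_point (\<lambda>i. b (Suc i))"
  using cantor_point_tail[of b] by (simp add: ternary_shift_def clamp_bit_cantor_point)

lemma cantor_bit_cantor_point: "cantor_bit i (cantor_point b) = of_bool (b i)"
proof -
  have "(ternary_shift ^^ i) (cantor_point b) = cantor_point (\<lambda>j. b (i + j))"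
  proof (induction i)
    case (Suc i)
    then show ?case
      by (simp add: ternary_shift_cantor_point)
  qed simp
  then show ?thesis
    by (simp add: cantor_bit_def clamp_bit_cantor_point)
qed

text \<open>Greedy digits from the doubling map: the remainder stays in [0, 1], so cutting after n
  digits leaves an error of at most \<open>(1/2) ^ n\<close>.\<close>

lemma binary_expansion:
  fixes y :: real
  assumes "0 \<le> y" "y \<le> 1"
  shows "\<exists>b :: nat \<Rightarrow> bool. (\<lambda>j. of_bool (b j) * (1 / 2) ^ Suc j) sums y"
proof -
  \<comment> \<open>With the digit 1 taken from \<open>r = 1/2\<close> upwards, the remainder 1 is a
    fixed point, so \<open>y = 1\<close> gets the expansion with all digits 1.\<close>
  define step where "step = (\<lambda>r :: real. 2 * r - of_bool (r \<ge> 1/2))"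
  define r where "r j = (step ^^ j) y" for j
  define b where "b j \<longleftrightarrow> r j \<ge> 1/2" for j
  have rec: "r (Suc j) = 2 * r j - of_bool (b j)" for j
    by (simp add: r_def b_def step_def)
  have bnd: "0 \<le> r j \<and> r j \<le> 1" for j
  proof (induction j)
    case 0
    then show ?case using assms by (simp add: r_def)
  next
    case (Suc j)
    then show ?case unfolding rec by (auto simp: b_def)
  qed
  have part: "(\<Sum>j<n. of_bool (b j) * (1 / 2) ^ Suc j) = y - r n * (1/2) ^ n" for n
  proof (induction n)
    case 0
    then show ?case by (simp add: r_def)
  next
    case (Suc n)
    have "(\<Sum>j<Suc n. of_bool (b j) * (1 / 2) ^ Suc j)
        = y - r n * (1/2) ^ n + of_bool (b n) * (1/2) ^ Suc n"
      by (simp only: sum.lessThan_Suc Suc)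
    also have "\<dots> = y - r (Suc n) * (1/2) ^ Suc n"
      by (simp add: rec field_simps)
    finally show ?case .
  qed
  have "(\<lambda>n. r n * (1/2) ^ n) \<longlonglongrightarrow> 0"
  proof (rule tendsto_sandwich[where f = "\<lambda>_. 0" and h = "\<lambda>n. (1/2 :: real) ^ n"])
    show "(\<lambda>n. (1/2 :: real) ^ n) \<longlonglongrightarrow> 0" by (rule LIMSEQ_realpow_zero) auto
    show "\<forall>\<^sub>F n in sequentially. 0 \<le> r n * (1/2) ^ n" using bnd by simp
    show "\<forall>\<^sub>F n in sequentially. r n * (1/2) ^ n \<le> (1/2) ^ n"
      by (simp add: mult_left_le_one_le bnd)
  qed simp
  then have "(\<lambda>n. y - r n * (1/2) ^ n) \<longlonglongrightarrow> y - 0"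
    by (intro tendsto_intros)
  then have "(\<lambda>j. of_bool (b j) * (1 / 2) ^ Suc j) sums y"
    unfolding sums_def part by simp
  then show ?thesis by blast
qed

text \<open>The pairing \<open>prod_encode\<close> splits one sequence of Cantor digits into
  countably many, each read as the binary expansion of one coordinate and moved from [0, 1] to
  [-1, 1]. A Cantor point can prescribe all digits at once, hence every value is attained. The
  functions live on the whole line because weak convergence is tested there.\<close>

lemma Hilbert_cube_parametrization:
  obtains X :: "nat \<Rightarrow> real \<Rightarrow> real"
  where "\<And>k. continuous_on UNIV (X k)" and "\<And>k t. \<bar>X k t\<bar> \<le> 1"
    and "\<And>v. (\<And>k. \<bar>v k\<bar> \<le> 1) \<Longrightarrow> \<exists>t\<in>{0..1}. \<forall>k. X k t = v k"
proof -
  define f where "f k j t = cantor_bit (prod_encode (k, j)) t * (1/2) ^ Suc j" for k j t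
  define X where "X k t = 2 * (\<Sum>j. f k j t) - 1" for k t
  have geom: "(\<lambda>j. (1/2 :: real) ^ Suc j) sums 1"
    using sums_mult[OF geometric_sums[of "1/2 :: real"], of "1/2"] by simp
  have f0: "0 \<le> f k j t" and f1: "f k j t \<le> (1/2) ^ Suc j" for k j t
    by (auto simp: f_def cantor_bit_bounds mult_left_le_one_le simp del: power_Suc)
  have sm: "summable (\<lambda>j. f k j t)" for k t
    by (rule summable_comparison_test'[OF sums_summable[OF geom], of 0])
       (use f0 f1 in \<open>simp del: power_Suc\<close>)
  show thesis
  proof
    fix k
    have "uniform_limit UNIV (\<lambda>n t. \<Sum>j<n. f k j t) (\<lambda>t. \<Sum>j. f k j t) sequentially"
      by (rule Weierstrass_m_test[OF _ sums_summable[OF geom]])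
         (use f0 f1 in \<open>simp del: power_Suc\<close>)
    then have "continuous_on UNIV (\<lambda>t. \<Sum>j. f k j t)"
      by (rule uniform_limit_theorem[rotated])
         (auto simp: f_def intro!: always_eventually continuous_intros continuous_on_cantor_bit)
    then show "continuous_on UNIV (X k)"
      unfolding X_def by (intro continuous_intros)
  next
    fix k t
    have "0 \<le> (\<Sum>j. f k j t)"
      by (rule suminf_nonneg[OF sm f0])
    moreover have "(\<Sum>j. f k j t) \<le> 1"
      using suminf_le[OF f1 sm sums_summable[OF geom]] sums_unique[OF geom] by simp
    ultimately show "\<bar>X k t\<bar> \<le> 1"
      by (simp add: X_def abs_le_iff)
  next
    fix v :: "nat \<Rightarrow> real"
    assume v: "\<And>k. \<bar>v k\<bar> \<le> 1"
    have "\<exists>b. (\<lambda>j. of_bool (b j) * (1 / 2) ^ Suc j) sums ((v k + 1) / 2)" for k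
      using v[of k] by (intro binary_expansion) (auto simp: abs_le_iff)
    then obtain b where b: "\<And>k. (\<lambda>j. of_bool (b k j) * (1 / 2) ^ Suc j) sums ((v k + 1) / 2)"
      by metis
    define t where "t = cantor_point (\<lambda>i. b (fst (prod_decode i)) (snd (prod_decode i)))"
    have "f k j t = of_bool (b k j) * (1 / 2) ^ Suc j" for k j
      by (simp add: f_def t_def cantor_bit_cantor_point)
    then have "X k t = v k" for k
      using sums_unique[OF b[of k]] by (simp add: X_def del: power_Suc)
    moreover have "t \<in> {0..1}"
      by (simp add: t_def cantor_point_bounds)
    ultimately show "\<exists>t\<in>{0..1}. \<forall>k. X k t = v k" by blast
  qed
qed

section \<open>Weak limits of discrete laws on the unit interval\<close>

text \<open>Laws on one compact interval are tight, so Helly's selection theorem applies. It yields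
  a measure on the line, whose concentration on [0, 1] has to be recovered separately.\<close>

lemma convergent_subsequence_unit_interval:
  fixes S :: "nat \<Rightarrow> 'a set" and p :: "nat \<Rightarrow> 'a \<Rightarrow> real" and \<tau> :: "nat \<Rightarrow> 'a \<Rightarrow> real"
  assumes fin: "\<And>n. finite (S n)" and p0: "\<And>n s. s \<in> S n \<Longrightarrow> 0 \<le> p n s"
    and p1: "\<And>n. (\<Sum>s\<in>S n. p n s) = 1"
    and \<tau>: "\<And>n s. s \<in> S n \<Longrightarrow> \<tau> n s \<in> {0..1}"
  obtains r :: "nat \<Rightarrow> nat" and M where "strict_mono r" "real_distribution M" "AE t in M. t \<in> {0..1}"
    "\<forall>f :: real \<Rightarrow> real. continuous_on UNIV f \<and> bounded (range f) \<longrightarrow>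
      (\<lambda>n. \<Sum>s\<in>S (r n). p (r n) s * f (\<tau> (r n) s)) \<longlonglongrightarrow> integral\<^sup>L M f"
proof -
  define \<mu> where "\<mu> n = distr (point_measure (S n) (p n)) borel (\<tau> n)" for n
  have ms [measurable]: "\<tau> n \<in> borel_measurable (point_measure (S n) (p n))" for n
    by simp
  have rd: "real_distribution (\<mu> n)" for n
  proof -
    have "prob_space (point_measure (S n) (p n))"
      using fin p0 p1 by (intro prob_space_point_measure) auto
    then have "prob_space (\<mu> n)"
      unfolding \<mu>_def by (rule prob_space.prob_space_distr) simp
    then show ?thesis
      unfolding real_distribution_def real_distribution_axioms_def by (simp add: \<mu>_def)
  qed
  have int: "integral\<^sup>L (\<mu> n) f = (\<Sum>s\<in>S n. p n s * f (\<tau> n s))"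
    if "continuous_on UNIV f" for n and f :: "real \<Rightarrow> real"
  proof -
    have [measurable]: "f \<in> borel_measurable borel"
      using that by (rule borel_measurable_continuous_onI)
    show ?thesis
      unfolding \<mu>_def
      by (subst integral_distr) (auto simp: lebesgue_integral_point_measure_finite fin p0)
  qed
  \<comment> \<open>Tightness is phrased with intervals \<open>{a<..b}\<close>; starting below 0
    keeps a possible atom at 0 inside.\<close>
  have unit: "measure (\<mu> n) {-1<..1} = 1" for n
  proof -
    interpret real_distribution "\<mu> n" by (rule rd)
    have "AE t in \<mu> n. t \<in> {-1<..1}"
      unfolding \<mu>_def by (subst AE_distr_iff) (auto simp: AE_point_measure dest!: \<tau>)
    then show "prob {-1<..1} = 1"
      by (subst prob_eq_1) auto
  qed
  have "tight \<mu>"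
    unfolding tight_def
  proof (intro conjI allI impI rd)
    fix e :: real
    assume "0 < e"
    then show "\<exists>a b. a < b \<and> (\<forall>n. 1 - e < measure (\<mu> n) {a<..b})"
      by (intro exI[of _ "-1"] exI[of _ 1]) (simp add: unit)
  qed
  from tight_imp_convergent_subsubsequence[OF this strict_mono_id]
  obtain r M where r: "strict_mono r" "real_distribution M" "weak_conv_m (\<mu> \<circ> r) M"
    by auto
  interpret M: real_distribution M by fact
  have lim: "(\<lambda>n. \<Sum>s\<in>S (r n). p (r n) s * f (\<tau> (r n) s)) \<longlonglongrightarrow> integral\<^sup>L M f"
    if f: "continuous_on UNIV f" "bounded (range f)" for f :: "real \<Rightarrow> real"
  proof -
    obtain B where B: "\<And>x. norm (f x) \<le> B"
      using f(2) unfolding bounded_iff by auto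
    have "\<And>x. isCont f x" using f(1) by (simp add: continuous_on_eq_continuous_at)
    from weak_conv_imp_integral_bdd_continuous_conv[OF _ r(2,3) this B] rd
    have "(\<lambda>n. integral\<^sup>L ((\<mu> \<circ> r) n) f) \<longlonglongrightarrow> integral\<^sup>L M f"
      by simp
    then show ?thesis by (simp add: int[OF f(1)])
  qed
  \<comment> \<open>The distance to [0, 1], cut off at 1: a bounded continuous test function whose
    zero set is exactly [0, 1]. Its integrals vanish along the sequence, hence in the limit.\<close>
  define \<phi> where "\<phi> t = min 1 (\<bar>t - max 0 (min 1 t)\<bar>)" for t :: real
  have \<phi>c: "continuous_on UNIV \<phi>" unfolding \<phi>_def by (intro continuous_intros)
  have [measurable]: "\<phi> \<in> borel_measurable borel"
    using \<phi>c by (rule borel_measurable_continuous_onI)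
  have \<phi>0: "\<phi> t = 0 \<longleftrightarrow> t \<in> {0..1}" for t by (auto simp: \<phi>_def min_def max_def)
  have \<phi>b: "norm (\<phi> t) \<le> 1" for t by (auto simp: \<phi>_def)
  have "(\<lambda>n. \<Sum>s\<in>S (r n). p (r n) s * \<phi> (\<tau> (r n) s)) = (\<lambda>n. 0)"
    using \<phi>0 \<tau> by (auto intro!: sum.neutral ext)
  moreover have "bounded (range \<phi>)" using \<phi>b by (auto simp: bounded_iff)
  ultimately have "integral\<^sup>L M \<phi> = 0"
    using lim[OF \<phi>c] by (simp add: LIMSEQ_const_iff)
  moreover have "integrable M \<phi>" using \<phi>b by (intro M.integrable_const_bound[of _ 1]) auto
  ultimately have "AE t in M. \<phi> t = 0"
    by (subst (asm) integral_nonneg_eq_0_iff_AE) (auto simp: \<phi>_def)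
  then have "AE t in M. t \<in> {0..1}" by (simp add: \<phi>0)
  with r lim that show thesis by blast
qed

subsection \<open>Real inner products and finite orthonormal systems\<close>

text \<open>The form is a parameter and not a type class operation, so that the real part of the
  given K-valued inner product can serve as \<open>B\<close>.\<close>

locale real_inner_form =
  fixes B :: "'h::banach \<Rightarrow> 'h \<Rightarrow> real"
  assumes add_left: "B (x + y) z = B x z + B y z"
    and scale_left: "B (r *\<^sub>R x) y = r * B x y"
    and commute: "B x y = B y x"
    and self: "B x x = (norm x)\<^sup>2"
begin

lemma add_right: "B x (y + z) = B x y + B x z"
  by (metis add_left commute)

lemma scale_right: "B x (r *\<^sub>R y) = r * B x y"
  by (metis scale_left commute)

lemma zero_left [simp]: "B 0 y = 0"
  using scale_left[of 0 0 y] by simp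

lemma zero_right [simp]: "B x 0 = 0"
  by (simp add: commute[of x])

lemma minus_left: "B (- x) y = - B x y"
  using scale_left[of "-1" x y] by simp

lemma diff_left: "B (x - y) z = B x z - B y z"
  using add_left[of x "-y" z] by (simp add: minus_left)

lemma diff_right: "B z (x - y) = B z x - B z y"
  by (simp add: commute[of z] diff_left)

lemma form_square: "B (x + r *\<^sub>R y) (x + r *\<^sub>R y) = B x x + 2 * r * B x y + r\<^sup>2 * B y y"
  by (simp add: add_left add_right scale_left scale_right commute[of y x] power2_eq_square
      algebra_simps)

lemma sum_left: "B (sum f S) y = (\<Sum>s\<in>S. B (f s) y)"
  by (induction S rule: infinite_finite_induct) (auto simp: add_left)

lemma norm_diff_square: "(norm (x - y))\<^sup>2 = (norm x)\<^sup>2 - 2 * B x y + (norm y)\<^sup>2"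
  by (simp flip: self add: diff_left diff_right commute[of y x])

lemma Cauchy_Schwarz: "\<bar>B x y\<bar> \<le> norm x * norm y"
proof (cases "y = 0")
  case False
  define c where "c = B x y / (norm y)\<^sup>2"
  have "0 \<le> (norm (x - c *\<^sub>R y))\<^sup>2" by simp
  also have "\<dots> = (norm x)\<^sup>2 - (B x y)\<^sup>2 / (norm y)\<^sup>2"
    unfolding norm_diff_square using False
    by (simp add: scale_right c_def power2_eq_square field_simps)
  finally have "(B x y)\<^sup>2 \<le> (norm x * norm y)\<^sup>2"
    using False by (simp add: field_simps)
  then show ?thesis
    using abs_le_square_iff[of "B x y" "norm x * norm y"] by simp
qed simp

lemma bounded_bilinear_form: "bounded_bilinear B"
  by standard (auto simp: add_left add_right scale_left scale_right
      intro!: exI[of _ 1] Cauchy_Schwarz)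

lemmas tendsto_form = bounded_bilinear.tendsto[OF bounded_bilinear_form]

lemmas continuous_on_form = bounded_bilinear.continuous_on[OF bounded_bilinear_form]

section \<open>Orthonormal systems, projections and compactness\<close>

definition orthonormal :: "'h set \<Rightarrow> bool"
  where "orthonormal T \<longleftrightarrow> finite T \<and> (\<forall>s\<in>T. \<forall>t\<in>T. B s t = (if s = t then 1 else 0))"

lemma orthonormalD:
  assumes "orthonormal T"
  shows "finite T" and "s \<in> T \<Longrightarrow> t \<in> T \<Longrightarrow> B s t = (if s = t then 1 else 0)"
  using assms by (auto simp: orthonormal_def)

lemma orthonormal_norm: "orthonormal T \<Longrightarrow> t \<in> T \<Longrightarrow> norm t = 1"
  using self[of t] orthonormalD(2)[of T t t] norm_ge_zero[of t] by (auto simp: power2_eq_1_iff)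

lemma orthonormal_insert:
  assumes "orthonormal T" "norm u = 1" "\<And>t. t \<in> T \<Longrightarrow> B u t = 0"
  shows "orthonormal (insert u T)" "u \<notin> T"
  using assms self[of u] by (auto simp: orthonormal_def commute)

definition proj :: "'h set \<Rightarrow> 'h \<Rightarrow> 'h"
  where "proj T x = (\<Sum>t\<in>T. B x t *\<^sub>R t)"

lemma proj_in_span: "proj T x \<in> span T"
  unfolding proj_def by (intro span_sum span_scale span_base)

lemma form_proj:
  assumes T: "orthonormal T" and t: "t \<in> T"
  shows "B (proj T x) t = B x t"
proof -
  have "B (proj T x) t = (\<Sum>s\<in>T. B x s * (if s = t then 1 else 0))"
    unfolding proj_def sum_left scale_left
    by (intro sum.cong) (use orthonormalD(2)[OF T] t in auto)
  also have "\<dots> = B x t"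
    using orthonormalD(1)[OF T] t by (simp add: if_distrib cong: if_cong)
  finally show ?thesis .
qed

lemma orthogonal_span:
  assumes "\<And>t. t \<in> T \<Longrightarrow> B x t = 0" "y \<in> span T"
  shows "B x y = 0"
  using assms(2) by (induction rule: span_induct_alt) (auto simp: add_right scale_right assms(1))

lemma form_residual:
  assumes "orthonormal T" "y \<in> span T"
  shows "B (x - proj T x) y = 0"
  by (rule orthogonal_span[OF _ assms(2)]) (simp add: diff_left form_proj assms(1))

lemma proj_span:
  assumes "orthonormal T" "x \<in> span T"
  shows "proj T x = x"
proof -
  have "x - proj T x \<in> span T"
    by (intro span_diff assms proj_in_span)
  from form_residual[OF assms(1) this] have "B (x - proj T x) (x - proj T x) = 0" .
  then show ?thesis by (simp add: self)
qed

text \<open>This turns sums over an orthonormal system into inner products, and so makes the Gram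
  matrices of coordinate functions accessible.\<close>

lemma parseval: "(\<Sum>t\<in>T. B x t * B y t) = B (proj T x) y"
  by (simp add: proj_def sum_left scale_left) (simp add: commute)

lemma norm_proj_le:
  assumes "orthonormal T"
  shows "norm (proj T x) \<le> norm x"
proof -
  have "(norm (proj T x))\<^sup>2 = B x (proj T x)"
    using form_residual[OF assms proj_in_span, of x x] by (simp add: diff_left self)
  also have "\<dots> \<le> norm x * norm (proj T x)"
    using Cauchy_Schwarz[of x "proj T x"] by simp
  finally show ?thesis
    by (cases "proj T x = 0") (auto simp: power2_eq_square)
qed

text \<open>The projection fixes \<open>y\<close>, so x and \<open>x - y\<close> have the same
  residual, and a residual is never longer than its vector.\<close>

lemma norm_residual_le:
  assumes "orthonormal T" "y \<in> span T"
  shows "norm (x - proj T x) \<le> norm (x - y)"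
proof -
  have eq: "x - proj T x = (x - y) - proj T (x - y)"
    using proj_span[OF assms]
    by (simp add: proj_def diff_left scaleR_left_diff_distrib sum_subtractf)
  have "(norm ((x - y) - proj T (x - y)))\<^sup>2 \<le> (norm (x - y))\<^sup>2"
  proof -
    have "B (x - y) (proj T (x - y)) = (norm (proj T (x - y)))\<^sup>2"
      using form_residual[OF assms(1) proj_in_span, of "x-y" "x-y"] by (simp add: diff_left self)
    then show ?thesis by (subst norm_diff_square) simp
  qed
  then show ?thesis unfolding eq by (rule power2_le_imp_le) simp
qed

text \<open>Gram-Schmidt, one vector at a time: a new vector is replaced by its normalised residual,
  or dropped if the residual is 0.\<close>

lemma orthonormal_basis:
  assumes "finite S"
  obtains T where "orthonormal T" "span T = span S"
proof -
  have "\<exists>T. orthonormal T \<and> span T = span S"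
    using assms
  proof (induction S)
    case empty
    then show ?case by (intro exI[of _ "{}"]) (auto simp: orthonormal_def)
  next
    case (insert a S)
    then obtain T where T: "orthonormal T" "span T = span S" by blast
    define b where "b = a - proj T a"
    have ab: "span (insert a S) = span (insert a T)"
      unfolding span_insert T(2) ..
    show ?case
    proof (cases "b = 0")
      case True
      then have "a \<in> span T" using proj_in_span[of T a] by (simp add: b_def)
      then show ?thesis using T ab by (auto simp: span_redundant)
    next
      case False
      define u where "u = b /\<^sub>R norm b"
      have "orthonormal (insert u T)"
        by (rule orthonormal_insert[OF T(1)])
          (use False in \<open>auto simp: u_def scale_left b_def form_residual[OF T(1)] span_base\<close>)
      moreover have "span (insert u T) = span (insert a T)"
      proof (rule subset_antisym; rule span_minimal)
        have p: "proj T a \<in> span (insert x T)" for x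
          using proj_in_span[of T a] span_mono[of T "insert x T"] by auto
        have "u \<in> span (insert a T)"
          unfolding u_def b_def by (intro span_scale span_diff p) (simp add: span_base)
        then show "insert u T \<subseteq> span (insert a T)" by (auto simp: span_base)
        have "a = norm b *\<^sub>R u + proj T a" using False by (simp add: u_def b_def)
        also have "\<dots> \<in> span (insert u T)"
          by (intro span_add span_scale p) (simp add: span_base)
        finally show "insert a T \<subseteq> span (insert u T)" by (auto simp: span_base)
      qed auto
      ultimately show ?thesis using ab by auto
    qed
  qed
  with that show thesis by blast
qed

text \<open>Orthonormal vectors are independent. The bound lets \<open>spectral_basis\<close> pick
  an orthonormal system of eigenvectors of greatest size.\<close>

lemma orthonormal_card_le:
  assumes "orthonormal T" "T \<subseteq> span S" "finite S"
  shows "card T \<le> card S"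
proof -
  have "independent T"
    unfolding dependent_finite[OF orthonormalD(1)[OF assms(1)]]
  proof
    assume "\<exists>c. (\<exists>t\<in>T. c t \<noteq> 0) \<and> (\<Sum>v\<in>T. c v *\<^sub>R v) = 0"
    then obtain c t where c: "(\<Sum>v\<in>T. c v *\<^sub>R v) = 0" "t \<in> T" and ct: "c t \<noteq> 0" by blast
    have "0 = B (\<Sum>v\<in>T. c v *\<^sub>R v) t" by (simp add: c)
    also have "\<dots> = (\<Sum>v\<in>T. c v * (if v = t then 1 else 0))"
      unfolding sum_left scale_left
      by (intro sum.cong) (use orthonormalD(2)[OF assms(1)] c in auto)
    also have "\<dots> = c t"
      using orthonormalD(1)[OF assms(1)] c by (simp add: if_distrib cong: if_cong)
    finally show False using ct by simp
  qed
  then show ?thesis using independent_span_bound[OF assms(3) _ assms(2)] by blast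
qed

text \<open>Bolzano-Weierstrass for one coefficient at a time, passing to a further subsequence for
  each element of \<open>T\<close>.\<close>

lemma convergent_coefficients:
  assumes "finite T" "bounded (range (f :: nat \<Rightarrow> 'h))"
  shows "\<exists>r :: nat \<Rightarrow> nat. strict_mono r \<and> (\<forall>t\<in>T. convergent (\<lambda>n. B (f (r n)) t))"
  using assms(1)
proof (induction T)
  case empty
  then show ?case using strict_mono_id by blast
next
  case (insert a T)
  then obtain r :: "nat \<Rightarrow> nat" where r: "strict_mono r" "\<And>t. t \<in> T \<Longrightarrow> convergent (\<lambda>n. B (f (r n)) t)"
    by blast
  obtain C where C: "\<And>n. norm (f n) \<le> C" using assms(2) by (auto simp: bounded_iff)
  have "bounded (range (\<lambda>n. B (f (r n)) a))"
    unfolding bounded_iff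
    by (auto intro!: exI[of _ "C * norm a"] order.trans[OF Cauchy_Schwarz] mult_right_mono C)
  from bounded_imp_convergent_subsequence[OF this]
  obtain l q where q: "strict_mono (q :: nat \<Rightarrow> nat)" "((\<lambda>n. B (f (r n)) a) \<circ> q) \<longlonglongrightarrow> l" by blast
  have "convergent (\<lambda>n. B (f ((r \<circ> q) n)) t)" if "t \<in> T" for t
    using convergent_subseq_convergent[OF r(2)[OF that] q(1)] by (simp add: comp_def)
  moreover have "convergent (\<lambda>n. B (f ((r \<circ> q) n)) a)"
    using q(2) by (auto simp: convergent_def comp_def)
  ultimately show ?case using strict_mono_o[OF r(1) q(1)] by auto
qed

text \<open>A vector of \<open>span T\<close> is determined by finitely many coefficients, so their
  convergence along a subsequence already gives convergence in norm. The remaining conditions are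
  closed.\<close>

lemma compact_unit_sphere:
  assumes T: "orthonormal T"
  shows "compact {x \<in> span T. norm x = 1 \<and> (\<forall>s\<in>S. B x s = 0)}" (is "compact ?K")
  unfolding compact_eq_seq_compact_metric seq_compact_def
proof safe
  fix f :: "nat \<Rightarrow> 'h"
  assume f: "\<forall>n. f n \<in> ?K"
  then have "bounded (range f)" by (auto simp: bounded_iff)
  from convergent_coefficients[OF orthonormalD(1)[OF T] this]
  obtain r :: "nat \<Rightarrow> nat" and c where r: "strict_mono r"
    and c: "\<And>t. t \<in> T \<Longrightarrow> (\<lambda>n. B (f (r n)) t) \<longlonglongrightarrow> c t"
    unfolding convergent_def by metis
  define l where "l = (\<Sum>t\<in>T. c t *\<^sub>R t)"
  have "(\<lambda>n. proj T (f (r n))) \<longlonglongrightarrow> l"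
    unfolding proj_def l_def by (intro tendsto_intros c)
  then have lim: "(\<lambda>n. f (r n)) \<longlonglongrightarrow> l"
    using f by (simp add: proj_span[OF T])
  have "l \<in> span T"
    unfolding l_def by (intro span_sum span_scale span_base)
  moreover have "norm l = 1"
    using tendsto_norm[OF lim] f by (simp add: LIMSEQ_const_iff)
  moreover have "B l s = 0" if "s \<in> S" for s
    using tendsto_form[OF lim tendsto_const[of s]] f that by (simp add: LIMSEQ_const_iff)
  ultimately show "\<exists>l\<in>?K. \<exists>r. strict_mono r \<and> (f \<circ> r) \<longlonglongrightarrow> l"
    using r lim by (auto simp: comp_def)
qed

end

section \<open>Diagonalisation of a symmetric form in finite dimension\<close>

text \<open>The laws of \<open>a\<close> are restricted to \<open>V\<close> since the form
  \<open>B (A x) y\<close> that it stands for is linear in \<open>x\<close> only on the domain of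
  \<open>A\<close>.\<close>

locale real_inner_form_sym = real_inner_form +
  fixes V :: "'a set" and a :: "'a \<Rightarrow> 'a \<Rightarrow> real"
  assumes a_add: "x \<in> V \<Longrightarrow> y \<in> V \<Longrightarrow> z \<in> V \<Longrightarrow> a (x + y) z = a x z + a y z"
    and a_scale: "x \<in> V \<Longrightarrow> y \<in> V \<Longrightarrow> a (r *\<^sub>R x) y = r * a x y"
    and a_commute: "x \<in> V \<Longrightarrow> y \<in> V \<Longrightarrow> a x y = a y x"
    and V_span: "\<exists>S. finite S \<and> V = span S"
begin

lemma V_add: "x \<in> V \<Longrightarrow> y \<in> V \<Longrightarrow> x + y \<in> V"
  using V_span span_add by blast

lemma V_scale: "x \<in> V \<Longrightarrow> r *\<^sub>R x \<in> V"
  using V_span span_scale by blast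

lemma V_zero: "0 \<in> V"
  using V_span span_zero by blast

lemma V_sum: "(\<And>s. s \<in> S \<Longrightarrow> f s \<in> V) \<Longrightarrow> sum f S \<in> V"
  by (induction S rule: infinite_finite_induct) (auto simp: V_add V_zero)

lemma a_zero: "y \<in> V \<Longrightarrow> a 0 y = 0"
  using a_scale[OF V_zero, of y 0] by simp

lemma a_sum: "(\<And>s. s \<in> S \<Longrightarrow> f s \<in> V) \<Longrightarrow> y \<in> V \<Longrightarrow> a (sum f S) y = (\<Sum>s\<in>S. a (f s) y)"
  by (induction S rule: infinite_finite_induct) (auto simp: a_add a_zero V_sum)

lemma a_add_right: "x \<in> V \<Longrightarrow> y \<in> V \<Longrightarrow> z \<in> V \<Longrightarrow> a x (y + z) = a x y + a x z"
  by (metis V_add a_add a_commute)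

lemma a_scale_right: "x \<in> V \<Longrightarrow> y \<in> V \<Longrightarrow> a x (r *\<^sub>R y) = r * a x y"
  by (metis V_scale a_scale a_commute)

lemma a_square:
  assumes "x \<in> V" "y \<in> V"
  shows "a (x + r *\<^sub>R y) (x + r *\<^sub>R y) = a x x + 2 * r * a x y + r\<^sup>2 * a y y"
  using assms a_commute[OF assms]
  by (simp add: a_add a_scale a_add_right a_scale_right V_add V_scale power2_eq_square
      algebra_simps)

text \<open>Maximise \<open>a x x\<close> over the unit sphere of the orthogonal complement of
  \<open>S\<close> in \<open>V\<close>. At a maximiser the first variation vanishes, which is the
  eigenvector equation tested on that complement; \<open>inv\<close> extends it to all of
  \<open>V\<close>.\<close>

lemma Rayleigh_eigenvector:
  assumes S: "orthonormal S" "S \<subseteq> V"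
    and inv: "\<And>x s. x \<in> V \<Longrightarrow> s \<in> S \<Longrightarrow> B x s = 0 \<Longrightarrow> a x s = 0"
    and ne: "z \<in> V" "z \<noteq> 0" "\<And>s. s \<in> S \<Longrightarrow> B z s = 0"
  obtains u l where "u \<in> V" "norm u = 1" "\<And>s. s \<in> S \<Longrightarrow> B u s = 0"
    "\<And>y. y \<in> V \<Longrightarrow> a u y = l * B u y"
proof -
  obtain T where T: "orthonormal T" "span T = V"
    using V_span orthonormal_basis by metis
  have TV: "t \<in> T \<Longrightarrow> t \<in> V" for t using T(2) span_base by blast
  define K where "K = {x \<in> V. norm x = 1 \<and> (\<forall>s\<in>S. B x s = 0)}"
  have "compact K"
    using compact_unit_sphere[OF T(1), of S] by (simp add: K_def T(2))
  moreover have "z /\<^sub>R norm z \<in> K"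
    using ne by (auto simp: K_def V_scale scale_left)
  moreover have "continuous_on K (\<lambda>x. a x x)"
  proof -
    \<comment> \<open>In coordinates \<open>a x x\<close> is a polynomial in the continuous
      functions \<open>B x t\<close>, so continuity follows from the algebraic laws.\<close>
    have *: "a x x = (\<Sum>s\<in>T. \<Sum>t\<in>T. B x s * (B x t * a t s))" if x: "x \<in> V" for x
    proof -
      have px: "x = (\<Sum>t\<in>T. B x t *\<^sub>R t)" using proj_span[OF T(1), of x] x T(2) by (simp add: proj_def)
      have ay: "a x y = (\<Sum>t\<in>T. B x t * a t y)" if "y \<in> V" for y
        using that by (subst px) (simp add: a_sum V_scale TV a_scale)
      have "a x x = (\<Sum>s\<in>T. B x s * a x s)"
        using x by (subst ay[OF x]) (auto intro!: sum.cong simp: a_commute[OF x] TV)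
      also have "\<dots> = (\<Sum>s\<in>T. \<Sum>t\<in>T. B x s * (B x t * a t s))"
        by (intro sum.cong) (auto simp: ay TV sum_distrib_left)
      finally show ?thesis .
    qed
    have "continuous_on K (\<lambda>x. \<Sum>s\<in>T. \<Sum>t\<in>T. B x s * (B x t * a t s))"
      by (intro continuous_intros continuous_on_form)
    then show ?thesis
      by (rule continuous_on_eq) (simp add: K_def *)
  qed
  ultimately obtain u where u: "u \<in> K" "\<And>x. x \<in> K \<Longrightarrow> a x x \<le> a u u"
    using continuous_attains_sup[of K "\<lambda>x. a x x"] by blast
  define l where "l = a u u"
  have uV: "u \<in> V" "norm u = 1" and uS: "\<And>s. s \<in> S \<Longrightarrow> B u s = 0" using u(1) by (auto simp: K_def)
  \<comment> \<open>Nonnegative on the complement of \<open>S\<close> by the choice of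
    \<open>l\<close>, and zero at \<open>u\<close>.\<close>
  define q where "q x = l * B x x - a x x" for x
  have q0: "0 \<le> q x" if x: "x \<in> V" "\<And>s. s \<in> S \<Longrightarrow> B x s = 0" for x
  proof (cases "x = 0")
    case False
    have nV: "x /\<^sub>R norm x \<in> V" using x V_scale by blast
    have "x /\<^sub>R norm x \<in> K"
      using x False by (auto simp: K_def V_scale scale_left)
    from u(2)[OF this] have "inverse (norm x) * (inverse (norm x) * a x x) \<le> l"
      using x nV by (simp add: l_def a_scale a_scale_right)
    then show ?thesis
      using False by (simp add: q_def self field_simps power2_eq_square)
  qed (simp add: q_def a_zero V_zero)
  have main: "a u y = l * B u y" if y: "y \<in> V" "\<And>s. s \<in> S \<Longrightarrow> B y s = 0" for y
  proof -
    define c where "c = l * B u y - a u y"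
    \<comment> \<open>The nonnegative \<open>q (u + e y)\<close> would be negative at this \<open>e\<close> unless \<open>c = 0\<close>.\<close>
    define e where "e = - c / (q y + 1)"
    have "q (u + e *\<^sub>R y) = q u + 2 * e * c + e\<^sup>2 * q y"
      unfolding q_def c_def a_square[OF uV(1) y(1)] form_square by (simp add: algebra_simps)
    moreover have "q u = 0" using uV by (simp add: q_def self l_def)
    moreover have "0 \<le> q (u + e *\<^sub>R y)"
      using y uV uS by (intro q0) (auto simp: V_add V_scale add_left scale_left)
    ultimately have "0 \<le> 2 * e * c + e\<^sup>2 * q y" by simp
    moreover have ed: "c = - e * (q y + 1)" using q0[OF y] by (simp add: e_def field_simps)
    ultimately have "e\<^sup>2 * (q y + 2) \<le> 0"
      by (simp add: power2_eq_square algebra_simps)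
    then have "e = 0"
      using q0[OF y] by (simp add: mult_le_0_iff)
    then have "c = 0" using ed by simp
    then show ?thesis by (simp add: c_def)
  qed
  \<comment> \<open>The part of \<open>y\<close> in \<open>span S\<close> contributes nothing on
    either side: \<open>u\<close> is orthogonal to it, and \<open>a\<close> pairs it with
    \<open>u\<close> to 0 by \<open>inv\<close>.\<close>
  have "a u y = l * B u y" if y: "y \<in> V" for y
  proof -
    define w where "w = y - proj S y"
    have pV: "proj S y \<in> V"
      unfolding proj_def using S by (intro V_sum V_scale) auto
    have w: "w \<in> V" "\<And>s. s \<in> S \<Longrightarrow> B w s = 0"
      using V_add[OF y V_scale[OF pV, of "-1"]] form_residual[OF S(1)]
      by (auto simp: w_def span_base)
    have "a (proj S y) u = 0"
    proof -
      have "a (proj S y) u = (\<Sum>s\<in>S. B y s * a s u)"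
        unfolding proj_def using S uV by (subst a_sum) (auto simp: V_scale a_scale intro!: sum.cong)
      also have "\<dots> = 0"
        using S uV uS inv[OF uV(1)] by (auto intro!: sum.neutral simp: a_commute[OF _ uV(1)] subsetD)
      finally show ?thesis .
    qed
    moreover have "B u (proj S y) = 0"
      by (rule orthogonal_span[OF uS proj_in_span])
    moreover have "y = w + proj S y" by (simp add: w_def)
    ultimately show ?thesis
      using main[OF w] uV w pV
      by (metis a_add a_commute add.right_neutral add_right V_add)
  qed
  with uV uS that show thesis by blast
qed

text \<open>An orthonormal set of eigenvectors of greatest cardinality spans \<open>V\<close>, for
  otherwise \<open>Rayleigh_eigenvector\<close> would add one more.\<close>

lemma spectral_basis:
  obtains T where "orthonormal T" "span T = V"
    "\<And>t. t \<in> T \<Longrightarrow> \<exists>l. \<forall>y\<in>V. a t y = l * B t y"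
proof -
  obtain S where S: "finite S" "V = span S" using V_span by blast
  define P where "P T \<longleftrightarrow> orthonormal T \<and> T \<subseteq> V \<and> (\<forall>t\<in>T. \<exists>l. \<forall>y\<in>V. a t y = l * B t y)" for T
  have "\<forall>T. P T \<longrightarrow> card T \<le> card S"
    using orthonormal_card_le S by (auto simp: P_def)
  moreover have "P {}" by (simp add: P_def orthonormal_def)
  ultimately obtain T where T: "P T" "\<And>T'. P T' \<Longrightarrow> card T' \<le> card T"
    using ex_has_greatest_nat[of P "{}" card "Suc (card S)"]
    by (auto simp: less_Suc_eq_le)
  have o: "orthonormal T" "T \<subseteq> V" using T(1) by (auto simp: P_def)
  have sub: "span T \<subseteq> V" using o(2) S(2) by (simp add: span_minimal)
  moreover have "V \<subseteq> span T"
  proof (rule ccontr)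
    assume "\<not> V \<subseteq> span T"
    then obtain y where y: "y \<in> V" "y \<notin> span T" by blast
    define z where "z = y - proj T y"
    have "z \<in> V"
      using V_add[OF y(1) V_scale[of "proj T y" "-1"]] proj_in_span[of T y] sub by (auto simp: z_def)
    moreover have "z \<noteq> 0" using y(2) proj_in_span[of T y] by (auto simp: z_def)
    moreover have "B z s = 0" if "s \<in> T" for s
      using form_residual[OF o(1) span_base[OF that]] by (simp add: z_def)
    \<comment> \<open>As \<open>s\<close> is an eigenvector, symmetry makes \<open>a x s\<close> a
      multiple of \<open>B x s\<close>.\<close>
    moreover have "a x s = 0" if xs: "x \<in> V" "s \<in> T" "B x s = 0" for x s
    proof -
      obtain l where "\<forall>y\<in>V. a s y = l * B s y" using T(1) xs unfolding P_def by blast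
      then show ?thesis using xs o(2) a_commute[of x s] by (auto simp: commute)
    qed
    ultimately obtain u l where u: "u \<in> V" "norm u = 1" "\<And>s. s \<in> T \<Longrightarrow> B u s = 0"
      "\<And>y. y \<in> V \<Longrightarrow> a u y = l * B u y"
      using Rayleigh_eigenvector[OF o] by metis
    have "P (insert u T)" "u \<notin> T"
      using orthonormal_insert[OF o(1) u(2,3)] T(1) u(1,4) by (auto simp: P_def)
    with T(2)[of "insert u T"] orthonormalD(1)[OF o(1)] show False by simp
  qed
  ultimately have "span T = V" by blast
  with o(1) T(1) that show thesis by (auto simp: P_def)
qed

end

subsection \<open>Square-integrable functions\<close>

lemma square_integrableD:
  assumes "f \<in> square_integrable M"
  shows "f \<in> borel_measurable M" "integrable M (\<lambda>x. (norm (f x))\<^sup>2)"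
  using assms by (auto simp: square_integrable_def)

lemma square_integrable_bound:
  fixes f :: "'a \<Rightarrow> 'k::rc_scalar"
  assumes "f \<in> borel_measurable M" "integrable M h" "AE x in M. (norm (f x))\<^sup>2 \<le> h x"
  shows "f \<in> square_integrable M"
  unfolding square_integrable_def
  using assms by (auto intro!: Bochner_Integration.integrable_bound[OF assms(2)])

lemma norm_add_square_le: "(norm (a + b))\<^sup>2 \<le> 2 * (norm a)\<^sup>2 + 2 * (norm (b::'a::real_normed_vector))\<^sup>2"
proof -
  have "(norm (a + b))\<^sup>2 \<le> (norm a + norm b)\<^sup>2"
    by (intro power_mono norm_triangle_ineq) simp
  also have "\<dots> \<le> 2 * (norm a)\<^sup>2 + 2 * (norm b)\<^sup>2"
    using sum_squares_bound[of "norm a" "norm b"] by (simp add: power2_sum)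
  finally show ?thesis .
qed

lemma square_integrable_add:
  fixes f g :: "'a \<Rightarrow> 'k::rc_scalar"
  assumes "f \<in> square_integrable M" "g \<in> square_integrable M"
  shows "(\<lambda>x. f x + g x) \<in> square_integrable M"
  using square_integrableD[OF assms(1)] square_integrableD[OF assms(2)]
  by (intro square_integrable_bound[where h = "\<lambda>x. 2 * (norm (f x))\<^sup>2 + 2 * (norm (g x))\<^sup>2"])
    (auto intro: norm_add_square_le)

lemma square_integrable_cmult:
  fixes f :: "'a \<Rightarrow> 'k::rc_scalar"
  assumes "f \<in> square_integrable M"
  shows "(\<lambda>x. c * f x) \<in> square_integrable M"
  using square_integrableD[OF assms]
  by (auto simp: square_integrable_def norm_mult power_mult_distrib)

lemma square_integrable_diff:
  fixes f g :: "'a \<Rightarrow> 'k::rc_scalar"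
  assumes "f \<in> square_integrable M" "g \<in> square_integrable M"
  shows "(\<lambda>x. f x - g x) \<in> square_integrable M"
  using square_integrable_add[OF assms(1) square_integrable_cmult[OF assms(2), of "-1"]] by simp

lemma square_integrable_mult:
  fixes f g :: "'a \<Rightarrow> 'k::rc_scalar"
  assumes "f \<in> square_integrable M" "g \<in> square_integrable M"
  shows "integrable M (\<lambda>x. f x * g x)"
proof (rule Bochner_Integration.integrable_bound)
  show "integrable M (\<lambda>x. (norm (f x))\<^sup>2 + (norm (g x))\<^sup>2)"
    using square_integrableD[OF assms(1)] square_integrableD[OF assms(2)] by auto
  have "norm a * norm b \<le> (norm a)\<^sup>2 + (norm b)\<^sup>2" for a b :: 'k
    using sum_squares_bound[of "norm a" "norm b"] mult_nonneg_nonneg[OF norm_ge_zero norm_ge_zero, of a b]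
    by linarith
  then show "AE x in M. norm (f x * g x) \<le> norm ((norm (f x))\<^sup>2 + (norm (g x))\<^sup>2)"
    by (simp add: norm_mult)
qed (use assms in \<open>auto simp: square_integrable_def\<close>)

lemma square_integrable_real_square:
  fixes f :: "'a \<Rightarrow> real"
  assumes "f \<in> square_integrable M"
  shows "integrable M (\<lambda>x. (f x)\<^sup>2)"
  using square_integrableD[OF assms] by simp

lemma integral_diff_square:
  fixes f g :: "'a \<Rightarrow> real"
  assumes "f \<in> square_integrable M" "g \<in> square_integrable M"
  shows "(\<integral>x. (f x - g x)\<^sup>2 \<partial>M)
    = (\<integral>x. f x * f x \<partial>M) - 2 * (\<integral>x. f x * g x \<partial>M) + (\<integral>x. g x * g x \<partial>M)"
proof -
  note i = square_integrable_mult[OF assms] square_integrable_mult[OF assms(1) assms(1)]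
    square_integrable_mult[OF assms(2) assms(2)]
  have "(\<integral>x. (f x - g x)\<^sup>2 \<partial>M) = (\<integral>x. f x * f x - 2 * (f x * g x) + g x * g x \<partial>M)"
    by (intro Bochner_Integration.integral_cong) (auto simp: power2_eq_square algebra_simps)
  then show ?thesis using i by simp
qed

text \<open>The integral of \<open>(f x - r * g x)\<^sup>2\<close> is a quadratic in r that is
  nonnegative for every r.\<close>

lemma integral_Cauchy_Schwarz:
  fixes f g :: "'a \<Rightarrow> real"
  assumes "f \<in> square_integrable M" "g \<in> square_integrable M"
  shows "\<bar>\<integral>x. f x * g x \<partial>M\<bar> \<le> sqrt (\<integral>x. (f x)\<^sup>2 \<partial>M) * sqrt (\<integral>x. (g x)\<^sup>2 \<partial>M)"
proof -
  define a p b where "a = (\<integral>x. f x * f x \<partial>M)" "p = (\<integral>x. f x * g x \<partial>M)" "b = (\<integral>x. g x * g x \<partial>M)"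
  note abp = this
  have nn: "0 \<le> a" "0 \<le> b" unfolding abp by (auto intro!: integral_nonneg_AE)
  have q: "0 \<le> a - 2 * (r * p) + r * (r * b)" for r
  proof -
    have "0 \<le> (\<integral>x. (f x - r * g x)\<^sup>2 \<partial>M)" by simp
    also have "\<dots> = a - 2 * (\<integral>x. r * (f x * g x) \<partial>M) + (\<integral>x. r * (r * (g x * g x)) \<partial>M)"
      unfolding integral_diff_square[OF assms(1) square_integrable_cmult[OF assms(2)]] abp
      by (simp only: mult_ac)
    also have "\<dots> = a - 2 * (r * p) + r * (r * b)"
      unfolding abp by simp
    finally show ?thesis .
  qed
  have "p\<^sup>2 \<le> a * b"
  proof (cases "b = 0")
    case True
    have "p = 0"
    proof (rule ccontr)
      assume "p \<noteq> 0"
      \<comment> \<open>For \<open>b = 0\<close> the quadratic is affine in r, and this r gives it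
        the value -1.\<close>
      then show False using q[of "(a + 1) / (2 * p)"] nn True by (simp add: field_simps)
    qed
    then show ?thesis by (simp add: nn)
  next
    case False
    then have "0 < b" using nn by simp
    \<comment> \<open>The minimiser of the quadratic.\<close>
    then show ?thesis using q[of "p / b"] by (simp add: field_simps power2_eq_square)
  qed
  then have "\<bar>p\<bar> \<le> sqrt (a * b)" using real_le_rsqrt[of "\<bar>p\<bar>"] by simp
  then show ?thesis by (simp add: abp real_sqrt_mult power2_eq_square)
qed

lemma tendsto_integral_mult:
  fixes f :: "nat \<Rightarrow> 'a \<Rightarrow> real" and g :: "'a \<Rightarrow> real"
  assumes f: "\<And>n. f n \<in> square_integrable M" "g \<in> square_integrable M"
    and h: "h \<in> square_integrable M"
    and lim: "(\<lambda>n. \<integral>x. (g x - f n x)\<^sup>2 \<partial>M) \<longlonglongrightarrow> 0"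
  shows "(\<lambda>n. \<integral>x. f n x * h x \<partial>M) \<longlonglongrightarrow> (\<integral>x. g x * h x \<partial>M)"
proof (rule Lim_null_comparison[THEN Lim_null[THEN iffD2]], rule always_eventually, rule allI)
  fix n
  have "(\<integral>x. f n x * h x \<partial>M) - (\<integral>x. g x * h x \<partial>M) = - (\<integral>x. (g x - f n x) * h x \<partial>M)"
    using square_integrable_mult[OF f(1) h, of n] square_integrable_mult[OF f(2) h]
    by (simp add: algebra_simps)
  then show "norm ((\<integral>x. f n x * h x \<partial>M) - (\<integral>x. g x * h x \<partial>M))
      \<le> sqrt (\<integral>x. (g x - f n x)\<^sup>2 \<partial>M) * sqrt (\<integral>x. (h x)\<^sup>2 \<partial>M)"
    using integral_Cauchy_Schwarz[OF square_integrable_diff[OF f(2) f(1)] h, of n] by simp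
next
  show "(\<lambda>n. sqrt (\<integral>x. (g x - f n x)\<^sup>2 \<partial>M) * sqrt (\<integral>x. (h x)\<^sup>2 \<partial>M)) \<longlonglongrightarrow> 0"
    using tendsto_mult[OF tendsto_real_sqrt[OF lim] tendsto_const] by simp
qed

text \<open>Cauchy-Schwarz against the constant 1, which has norm 1 because the measure is a
  probability.\<close>

lemma (in prob_space) integral_abs_le_L2:
  fixes f :: "'a \<Rightarrow> real"
  assumes "f \<in> square_integrable M"
  shows "integrable M (\<lambda>x. \<bar>f x\<bar>)" "(\<integral>x. \<bar>f x\<bar> \<partial>M) \<le> sqrt (\<integral>x. (f x)\<^sup>2 \<partial>M)"
proof -
  have a: "(\<lambda>x. \<bar>f x\<bar>) \<in> square_integrable M" and o: "(\<lambda>x. 1 :: real) \<in> square_integrable M"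
    using assms by (auto simp: square_integrable_def)
  show "integrable M (\<lambda>x. \<bar>f x\<bar>)" using square_integrable_mult[OF a o] by simp
  have "\<bar>\<integral>x. \<bar>f x\<bar> \<partial>M\<bar> \<le> sqrt (\<integral>x. (f x)\<^sup>2 \<partial>M)"
    using integral_Cauchy_Schwarz[OF a o] by (simp add: prob_space)
  then show "(\<integral>x. \<bar>f x\<bar> \<partial>M) \<le> sqrt (\<integral>x. (f x)\<^sup>2 \<partial>M)" by simp
qed

text \<open>Riesz-Fischer: on a probability space an L2 Cauchy sequence is Cauchy in L1, so a
  subsequence converges almost everywhere, and Fatou's lemma makes the pointwise limit an L2 limit
  of the whole sequence.\<close>

lemma (in prob_space) L2_complete:
  fixes f :: "nat \<Rightarrow> 'a \<Rightarrow> real"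
  assumes f: "\<And>n. f n \<in> square_integrable M"
    and cauchy: "\<And>e. e > 0 \<Longrightarrow> \<exists>N. \<forall>m\<ge>N. \<forall>n\<ge>N. (\<integral>x. (f m x - f n x)\<^sup>2 \<partial>M) < e"
  obtains g where "g \<in> square_integrable M" "(\<lambda>n. \<integral>x. (g x - f n x)\<^sup>2 \<partial>M) \<longlonglongrightarrow> 0"
proof -
  have [measurable]: "f n \<in> borel_measurable M" for n
    using f by (rule square_integrableD)
  have int: "integrable M (f n)" for n
    using integral_abs_le_L2(1)[OF f] by (rule integrable_abs_iff[THEN iffD1, rotated]) simp
  have "\<exists>N. \<forall>i\<ge>N. \<forall>j\<ge>N. (\<integral>x. norm (f i x - f j x) \<partial>M) < e" if "e > 0" for e
  proof -
    obtain N where N: "\<And>m n. m \<ge> N \<Longrightarrow> n \<ge> N \<Longrightarrow> (\<integral>x. (f m x - f n x)\<^sup>2 \<partial>M) < e\<^sup>2"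
      using cauchy[of "e\<^sup>2"] \<open>e > 0\<close> by auto
    have "(\<integral>x. norm (f i x - f j x) \<partial>M) < e" if "i \<ge> N" "j \<ge> N" for i j
    proof -
      have "(\<integral>x. norm (f i x - f j x) \<partial>M) \<le> sqrt (\<integral>x. (f i x - f j x)\<^sup>2 \<partial>M)"
        using integral_abs_le_L2(2)[OF square_integrable_diff[OF f f]] by simp
      also have "\<dots> < sqrt (e\<^sup>2)" using N[OF that] by (rule real_sqrt_less_mono)
      finally show ?thesis using \<open>e > 0\<close> by simp
    qed
    then show ?thesis by blast
  qed
  from cauchy_L1_AE_cauchy_subseq[OF int this]
  obtain r where r: "strict_mono r" "AE x in M. Cauchy (\<lambda>i. f (r i) x)" by blast
  define g where "g x = lim (\<lambda>i. f (r i) x)" for x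
  have [measurable]: "g \<in> borel_measurable M" unfolding g_def by measurable
  have lim: "AE x in M. (\<lambda>i. f (r i) x) \<longlonglongrightarrow> g x"
    using r(2) by eventually_elim (auto simp: g_def Cauchy_convergent_iff convergent_LIMSEQ_iff)
  have bound: "(\<integral>\<^sup>+x. ennreal ((g x - f n x)\<^sup>2) \<partial>M) \<le> ennreal e"
    if N: "\<And>m n. m \<ge> N \<Longrightarrow> n \<ge> N \<Longrightarrow> (\<integral>x. (f m x - f n x)\<^sup>2 \<partial>M) < e" and n: "n \<ge> N" for N n e
  proof -
    have "(\<integral>\<^sup>+x. ennreal ((g x - f n x)\<^sup>2) \<partial>M)
        = (\<integral>\<^sup>+x. liminf (\<lambda>i. ennreal ((f (r i) x - f n x)\<^sup>2)) \<partial>M)"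
    proof (rule nn_integral_cong_AE, use lim in eventually_elim)
      case (elim x)
      have "(\<lambda>i. ennreal ((f (r i) x - f n x)\<^sup>2)) \<longlonglongrightarrow> ennreal ((g x - f n x)\<^sup>2)"
        by (intro tendsto_intros elim tendsto_ennrealI)
      then show ?case using lim_imp_Liminf by (metis sequentially_bot)
    qed
    also have "\<dots> \<le> liminf (\<lambda>i. \<integral>\<^sup>+x. ennreal ((f (r i) x - f n x)\<^sup>2) \<partial>M)"
      by (rule nn_integral_liminf) measurable
    also have "\<dots> = liminf (\<lambda>i. ennreal (\<integral>x. (f (r i) x - f n x)\<^sup>2 \<partial>M))"
      using square_integrable_real_square[OF square_integrable_diff[OF f f]]
      by (simp add: nn_integral_eq_integral)
    also have "\<dots> \<le> limsup (\<lambda>i. ennreal (\<integral>x. (f (r i) x - f n x)\<^sup>2 \<partial>M))"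
      by (rule Liminf_le_Limsup) simp
    also have "\<dots> \<le> ennreal e"
    proof (rule Limsup_bounded, rule eventually_sequentiallyI)
      fix i assume "N \<le> i"
      \<comment> \<open>\<open>r i \<ge> i\<close> keeps the subsequence in the range where the
        Cauchy bound holds.\<close>
      then have "N \<le> r i" using seq_suble[OF r(1), of i] by simp
      then show "ennreal (\<integral>x. (f (r i) x - f n x)\<^sup>2 \<partial>M) \<le> ennreal e"
        using N[of "r i" n] n by (intro ennreal_leI) simp
    qed
    finally show ?thesis .
  qed
  have int2: "integrable M (\<lambda>x. (g x - f n x)\<^sup>2)" and int2_le: "(\<integral>x. (g x - f n x)\<^sup>2 \<partial>M) \<le> e"
    if N: "\<And>m n. m \<ge> N \<Longrightarrow> n \<ge> N \<Longrightarrow> (\<integral>x. (f m x - f n x)\<^sup>2 \<partial>M) < e" and n: "n \<ge> N" and e: "0 < e"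
    for N n e
  proof -
    note b = bound[OF N n]
    then have "(\<integral>\<^sup>+x. ennreal ((g x - f n x)\<^sup>2) \<partial>M) < \<infinity>"
      using ennreal_less_top[of e] by (simp add: le_less_trans)
    then show i: "integrable M (\<lambda>x. (g x - f n x)\<^sup>2)"
      by (intro integrableI_bounded) auto
    from b show "(\<integral>x. (g x - f n x)\<^sup>2 \<partial>M) \<le> e"
      using e by (simp add: nn_integral_eq_integral[OF i])
  qed
  show thesis
  proof
    obtain N where N: "\<And>m n. m \<ge> N \<Longrightarrow> n \<ge> N \<Longrightarrow> (\<integral>x. (f m x - f n x)\<^sup>2 \<partial>M) < 1"
      using cauchy[of 1] by auto
    have "(\<lambda>x. g x - f N x) \<in> square_integrable M"
      using int2[of N 1 N] N by (simp add: square_integrable_def)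
    from square_integrable_add[OF this f[of N]] show "g \<in> square_integrable M" by simp
    show "(\<lambda>n. \<integral>x. (g x - f n x)\<^sup>2 \<partial>M) \<longlonglongrightarrow> 0"
    proof (rule LIMSEQ_I)
      fix e :: real assume "0 < e"
      then obtain N where N: "\<And>m n. m \<ge> N \<Longrightarrow> n \<ge> N \<Longrightarrow> (\<integral>x. (f m x - f n x)\<^sup>2 \<partial>M) < e / 2"
        using cauchy[of "e/2"] by auto
      have "norm ((\<integral>x. (g x - f n x)\<^sup>2 \<partial>M) - 0) < e" if "n \<ge> N" for n
        using int2_le[of N "e/2" n] N that \<open>0 < e\<close> by simp
      then show "\<exists>N. \<forall>n\<ge>N. norm ((\<integral>x. (g x - f n x)\<^sup>2 \<partial>M) - 0) < e" by blast
    qed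
  qed
qed

text \<open>Phrased through inner products, so that Gram identities alone yield equality almost
  everywhere; this is how values, sums and multiples under the isometry are identified.\<close>

lemma AE_eq_of_integral_square_diff:
  fixes f g :: "'a \<Rightarrow> real"
  assumes "f \<in> square_integrable M" "g \<in> square_integrable M"
    and "(\<integral>x. f x * f x \<partial>M) - 2 * (\<integral>x. f x * g x \<partial>M) + (\<integral>x. g x * g x \<partial>M) = 0"
  shows "AE x in M. f x = g x"
proof -
  have "(\<integral>x. (f x - g x)\<^sup>2 \<partial>M) = 0"
    using assms(3) by (simp add: integral_diff_square[OF assms(1,2)])
  then have "AE x in M. (f x - g x)\<^sup>2 = 0"
    by (subst (asm) integral_nonneg_eq_0_iff_AE)
      (auto intro: square_integrable_real_square[OF square_integrable_diff[OF assms(1,2)]])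
  then show ?thesis by simp
qed

subsection \<open>Limits of orthonormal systems\<close>

context real_inner_form
begin

text \<open>By \<open>parseval\<close>, sums over \<open>T n\<close> of products of two coordinates
  \<open>B (z k) t\<close> are inner products that converge to the Gram matrix of the
  \<open>z k\<close>. Giving \<open>t\<close> the mass \<open>w n t\<close> and dividing each
  coordinate by \<open>sqrt (w n t)\<close> leaves these sums unchanged and keeps identities between
  such products, so both pass to the weak limit.\<close>

lemma limit_of_orthonormal_systems:
  fixes z :: "nat \<Rightarrow> 'h" and T :: "nat \<Rightarrow> 'h set"
  assumes T: "\<And>n. orthonormal (T n)"
    and lim: "\<And>k. (\<lambda>n. proj (T n) (z k)) \<longlonglongrightarrow> z k"
  obtains M :: "real measure" and Z :: "nat \<Rightarrow> real \<Rightarrow> real"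
  where "real_distribution M" "AE t in M. t \<in> {0..1}"
    "\<And>k. Z k \<in> borel_measurable borel" "\<And>k. Z k \<in> square_integrable M"
    "\<And>j k. (\<integral>t. Z j t * Z k t \<partial>M) = B (z j) (z k)"
    "\<And>i j k l. (\<forall>\<^sub>F n in sequentially. \<forall>t\<in>T n. B (z i) t * B (z j) t = B (z k) t * B (z l) t) \<longrightarrow>
      (AE t in M. Z i t * Z j t = Z k t * Z l t)"
proof -
  obtain X :: "nat \<Rightarrow> real \<Rightarrow> real"
    where Xc: "\<And>k. continuous_on UNIV (X k)" and Xb: "\<And>k t. \<bar>X k t\<bar> \<le> 1"
      and Xs: "\<And>v. (\<And>k. \<bar>v k\<bar> \<le> 1) \<Longrightarrow> \<exists>t\<in>{0..1}. \<forall>k. X k t = v k"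
    using Hilbert_cube_parametrization by blast
  \<comment> \<open>The factor \<open>(1/2) ^ Suc k\<close> keeps the total weight of
    \<open>T n\<close> at most 1; the denominator compensates the length of \<open>z k\<close>, and
    its summand 1 covers \<open>z k = 0\<close>.\<close>
  define c where "c k = (1/2) ^ Suc k / (1 + (norm (z k))\<^sup>2)" for k
  have c0: "0 < c k" for k
    by (simp add: c_def add_pos_nonneg)
  define w where "w n t = (\<Sum>k<n. c k * (B (z k) t)\<^sup>2)" for n t
  have w0: "0 \<le> w n t" for n t
    unfolding w_def using c0 by (intro sum_nonneg mult_nonneg_nonneg) (auto simp: less_imp_le)
  have wle: "c k * (B (z k) t)\<^sup>2 \<le> w n t" if "k < n" for n k t
    unfolding w_def using that c0
    by (intro member_le_sum) (auto simp: less_imp_le intro!: mult_nonneg_nonneg)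
  have wz: "B (z k) t = 0" if "w n t = 0" "k < n" for n k t
    using wle[OF that(2), of t] c0[of k] that(1) by (auto simp: mult_le_0_iff)
  have wsum: "(\<Sum>t\<in>T n. w n t) \<le> 1" for n
  proof -
    have "(\<Sum>t\<in>T n. w n t) = (\<Sum>k<n. c k * (\<Sum>t\<in>T n. B (z k) t * B (z k) t))"
      unfolding w_def by (subst sum.swap) (simp add: sum_distrib_left power2_eq_square)
    also have "\<dots> \<le> (\<Sum>k<n. (1/2) ^ Suc k)"
    proof (rule sum_mono)
      fix k
      have "(\<Sum>t\<in>T n. B (z k) t * B (z k) t) \<le> norm (proj (T n) (z k)) * norm (z k)"
        unfolding parseval using Cauchy_Schwarz[of "proj (T n) (z k)" "z k"] by simp
      also have "\<dots> \<le> 1 + (norm (z k))\<^sup>2"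
        using norm_proj_le[OF T, of n "z k"]
        by (simp add: power2_eq_square mult_right_mono add_increasing)
      finally have "c k * (\<Sum>t\<in>T n. B (z k) t * B (z k) t) \<le> c k * (1 + (norm (z k))\<^sup>2)"
        using c0[of k] by (intro mult_left_mono) auto
      also have "\<dots> = (1/2) ^ Suc k"
      proof -
        have "1 + (norm (z k))\<^sup>2 \<noteq> 0"
          using zero_le_power2[of "norm (z k)"] by linarith
        then show ?thesis
          unfolding c_def by (simp del: power_Suc)
      qed
      finally show "c k * (\<Sum>t\<in>T n. B (z k) t * B (z k) t) \<le> (1/2) ^ Suc k" .
    qed
    also have "\<dots> = 1 - (1/2) ^ n"
      by (induction n) (auto simp: field_simps)
    also have "\<dots> \<le> (1 :: real)" by simp
    finally show ?thesis .
  qed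
  define S where "S n = insert 0 (T n)" for n
  have zT: "0 \<notin> T n" for n
    using orthonormal_norm[OF T, of 0 n] by auto
  have fT: "finite (T n)" for n using orthonormalD(1)[OF T] .
  \<comment> \<open>The point \<open>0\<close>, where all functions vanish, carries the mass missing to a probability.\<close>
  define p where "p n t = (if t = 0 then 1 - (\<Sum>t\<in>T n. w n t) else w n t)" for n t
  have psum: "(\<Sum>t\<in>S n. p n t * f t) = p n 0 * f 0 + (\<Sum>t\<in>T n. w n t * f t)"
    for n and f :: "'h \<Rightarrow> real"
  proof -
    have "(\<Sum>t\<in>T n. p n t * f t) = (\<Sum>t\<in>T n. w n t * f t)"
      using zT[of n] by (intro sum.cong) (auto simp: p_def)
    then show ?thesis unfolding S_def using zT fT by simp
  qed
  \<comment> \<open>Where \<open>w n t = 0\<close> the division yields 0, which does no harm: by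
    \<open>wz\<close> the coordinates with index below \<open>n\<close> vanish there.\<close>
  define v where "v n k t = (if k < n then B (z k) t / sqrt (w n t) else 0)" for n k t
  \<comment> \<open>From \<open>c k * (B (z k) t)\<^sup>2 \<le> w n t\<close>: a bound for
    \<open>v n k t\<close> that does not depend on \<open>n\<close>.\<close>
  define b where "b k = 1 / sqrt (c k)" for k
  have b0: "0 < b k" for k by (simp add: b_def c0)
  have vb: "\<bar>v n k t / b k\<bar> \<le> 1" for n k t
  proof (cases "k < n \<and> w n t \<noteq> 0")
    case True
    then have "0 < w n t" using w0[of n t] by simp
    have "sqrt (c k * (B (z k) t)\<^sup>2) \<le> sqrt (w n t)"
      using wle True by (simp add: real_sqrt_le_mono)
    then have "sqrt (c k) * \<bar>B (z k) t\<bar> \<le> sqrt (w n t)"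
      by (simp add: real_sqrt_mult)
    then show ?thesis
      using True \<open>0 < w n t\<close> c0[of k] by (simp add: v_def b_def abs_mult field_simps)
  qed (auto simp: v_def)
  \<comment> \<open>The normalised coordinates of \<open>t\<close> form a point of the Hilbert cube
    and are coded by one number, so that a law on [0, 1] carries all of them jointly.\<close>
  have "\<exists>s\<in>{0..1}. \<forall>k. X k s = v n k t / b k" for n t
    using Xs[of "\<lambda>k. v n k t / b k"] vb by blast
  then obtain \<tau> where \<tau>: "\<And>n t. \<tau> n t \<in> {0..1}" "\<And>n t k. X k (\<tau> n t) = v n k t / b k"
    by metis
  have fS: "finite (S n)" for n using fT by (simp add: S_def)
  have p0: "0 \<le> p n t" for n t using w0 wsum by (simp add: p_def)
  have p1: "(\<Sum>t\<in>S n. p n t) = 1" for n using psum[of n "\<lambda>_. 1"] by (simp add: p_def)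
  obtain r M where r: "strict_mono (r :: nat \<Rightarrow> nat)" and M: "real_distribution M"
      and M01: "AE t in M. t \<in> {0..1}"
      and conv_all: "\<forall>f :: real \<Rightarrow> real. continuous_on UNIV f \<and> bounded (range f) \<longrightarrow>
        (\<lambda>n. \<Sum>s\<in>S (r n). p (r n) s * f (\<tau> (r n) s)) \<longlonglongrightarrow> integral\<^sup>L M f"
    by (rule convergent_subsequence_unit_interval[of S p \<tau>, OF fS p0 p1 \<tau>(1)])
  have conv: "(\<lambda>n. \<Sum>s\<in>S (r n). p (r n) s * f (\<tau> (r n) s)) \<longlonglongrightarrow> integral\<^sup>L M f"
    if "continuous_on UNIV f" "bounded (range f)" for f :: "real \<Rightarrow> real"
    using conv_all that by blast
  interpret M: real_distribution M by fact
  define Z where "Z k t = b k * X k t" for k t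
  have Zc: "continuous_on UNIV (Z k)" for k
    unfolding Z_def by (intro continuous_intros Xc)
  have Zm [measurable]: "Z k \<in> borel_measurable borel" for k
    using Zc by (rule borel_measurable_continuous_onI)
  have Zb: "\<bar>Z k t\<bar> \<le> b k" for k t
    using mult_left_mono[OF Xb[of k t], of "b k"] b0[of k] by (simp add: Z_def abs_mult)
  have Z\<tau>: "Z k (\<tau> n t) = v n k t" for k n t
    using b0[of k] by (simp add: Z_def \<tau>(2))
  have Zb2: "\<bar>Z j t * Z k t\<bar> \<le> b j * b k" for j k t
    unfolding abs_mult using Zb b0[of j] by (intro mult_mono) auto
  have Zs: "Z k \<in> square_integrable M" for k
    using Zb2[of k _ k]
    by (intro square_integrable_bound[where h = "\<lambda>_. b k * b k"])
      (auto simp: power2_eq_square abs_mult)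
  have ZB: "(\<integral>t. Z j t * Z k t \<partial>M) = B (z j) (z k)" for j k
  proof -
    have "(\<lambda>n. \<Sum>s\<in>S (r n). p (r n) s * (Z j (\<tau> (r n) s) * Z k (\<tau> (r n) s)))
        \<longlonglongrightarrow> (\<integral>t. Z j t * Z k t \<partial>M)"
      using Zb2 by (intro conv continuous_intros Zc) (auto simp: bounded_iff)
    \<comment> \<open>Only eventually, since \<open>v n k\<close> is 0 unless
      \<open>k < n\<close>.\<close>
    moreover have "\<forall>\<^sub>F n in sequentially.
        (\<Sum>s\<in>S (r n). p (r n) s * (Z j (\<tau> (r n) s) * Z k (\<tau> (r n) s))) = B (proj (T (r n)) (z j)) (z k)"
    proof (rule eventually_sequentiallyI)
      fix n assume "max (Suc j) (Suc k) \<le> n"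
      then have n: "j < r n" "k < r n" using seq_suble[OF r, of n] by auto
      have *: "w (r n) t * (v (r n) j t * v (r n) k t) = B (z j) t * B (z k) t" for t
        using n w0[of "r n" t] wz[of "r n" t] by (cases "w (r n) t = 0") (auto simp: v_def)
      \<comment> \<open>The additional atom 0 contributes nothing, as \<open>v\<close> vanishes
        there.\<close>
      show "(\<Sum>s\<in>S (r n). p (r n) s * (Z j (\<tau> (r n) s) * Z k (\<tau> (r n) s)))
          = B (proj (T (r n)) (z j)) (z k)"
        unfolding psum Z\<tau> * parseval by (simp add: v_def)
    qed
    ultimately have "(\<lambda>n. B (proj (T (r n)) (z j)) (z k)) \<longlonglongrightarrow> (\<integral>t. Z j t * Z k t \<partial>M)"
      by (rule Lim_transform_eventually)
    moreover have "(\<lambda>n. B (proj (T (r n)) (z j)) (z k)) \<longlonglongrightarrow> B (z j) (z k)"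
      using LIMSEQ_subseq_LIMSEQ[OF lim[of j] r] unfolding comp_def
      by (intro tendsto_form tendsto_const)
    ultimately show ?thesis by (rule LIMSEQ_unique)
  qed
  have "AE t in M. Z i t * Z j t = Z k t * Z l t"
    if ev: "\<forall>\<^sub>F n in sequentially. \<forall>t\<in>T n. B (z i) t * B (z j) t = B (z k) t * B (z l) t" for i j k l
  proof -
    \<comment> \<open>The squared defect of the relation is a bounded continuous test function that
      vanishes at all atoms from some index on. Being nonnegative with limit integral 0, it vanishes
      almost everywhere.\<close>
    define q where "q t = (Z i t * Z j t - Z k t * Z l t)\<^sup>2" for t
    have qc: "continuous_on UNIV q" unfolding q_def by (intro continuous_intros Zc)
    have [measurable]: "q \<in> borel_measurable borel" unfolding q_def by measurable
    have qb: "norm (q t) \<le> (b i * b j + b k * b l)\<^sup>2" for t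
    proof -
      have "\<bar>Z i t * Z j t - Z k t * Z l t\<bar> \<le> b i * b j + b k * b l"
        using Zb2[of i t j] Zb2[of k t l] by linarith
      then show ?thesis
        unfolding q_def by (simp add: abs_le_square_iff[symmetric])
    qed
    have q_lim: "(\<lambda>n. \<Sum>s\<in>S (r n). p (r n) s * q (\<tau> (r n) s)) \<longlonglongrightarrow> integral\<^sup>L M q"
      using qb by (intro conv qc) (auto simp: bounded_iff)
    have q_ev: "\<forall>\<^sub>F n in sequentially. (\<Sum>s\<in>S (r n). p (r n) s * q (\<tau> (r n) s)) = 0"
    proof -
      obtain N where N: "\<And>n t. n \<ge> N \<Longrightarrow> t \<in> T n \<Longrightarrow> B (z i) t * B (z j) t = B (z k) t * B (z l) t"
        using ev unfolding eventually_sequentially by blast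
      show ?thesis
      proof (rule eventually_sequentiallyI)
        fix n assume "max N (max (max (Suc i) (Suc j)) (max (Suc k) (Suc l))) \<le> n"
        then have n: "N \<le> r n" "i < r n" "j < r n" "k < r n" "l < r n"
          using seq_suble[OF r, of n] by auto
        have "q (\<tau> (r n) t) = 0" if "t \<in> T (r n)" for t
        proof -
          have "v (r n) i t * v (r n) j t = v (r n) k t * v (r n) l t"
            using N[OF n(1) that] n by (simp add: v_def)
          then show ?thesis unfolding q_def Z\<tau> by simp
        qed
        moreover have "q (\<tau> (r n) 0) = 0"
          by (simp add: q_def Z\<tau> v_def)
        ultimately show "(\<Sum>s\<in>S (r n). p (r n) s * q (\<tau> (r n) s)) = 0"
          by (intro sum.neutral) (auto simp: S_def)
      qed
    qed
    have "integral\<^sup>L M q = 0"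
      by (rule LIMSEQ_unique[OF q_lim tendsto_eventually[OF q_ev]])
    moreover have "integrable M q"
      using qb by (intro M.integrable_const_bound) auto
    ultimately have "AE t in M. q t = 0"
      by (subst (asm) integral_nonneg_eq_0_iff_AE) (auto simp: q_def)
    then show ?thesis by (simp add: q_def)
  qed
  then show thesis using that[OF M M01 Zm Zs ZB] by blast
qed

section \<open>Extension of an isometry from a dense sequence\<close>

text \<open>Sending \<open>z k\<close> to \<open>Z k\<close> preserves the Gram matrix and hence
  distances, so approximants of x become a Cauchy sequence, and completeness supplies
  \<open>F x\<close>. Linearity of \<open>F\<close> can later be read off from the inner
  products.\<close>

lemma isometric_extension:
  fixes z :: "nat \<Rightarrow> 'h" and Z :: "nat \<Rightarrow> 'b \<Rightarrow> real"
  assumes M: "prob_space M" and dense: "closure (range z) = UNIV"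
    and Zs: "\<And>k. Z k \<in> square_integrable M"
    and ZB: "\<And>j k. (\<integral>t. Z j t * Z k t \<partial>M) = B (z j) (z k)"
  obtains F where "\<And>x. F x \<in> square_integrable M" "\<And>x y. (\<integral>t. F x t * F y t \<partial>M) = B x y"
    "\<And>k. AE t in M. F (z k) t = Z k t"
proof -
  interpret prob_space M by fact
  have dist: "(\<integral>t. (Z j t - Z k t)\<^sup>2 \<partial>M) = (norm (z j - z k))\<^sup>2" for j k
    by (simp add: integral_diff_square Zs ZB norm_diff_square self)
  \<comment> \<open>Limit and approximating indices are bundled, so that one choice provides both
    for every \<open>x\<close>.\<close>
  define R where "R x g ks \<longleftrightarrow> g \<in> square_integrable M \<and> (\<lambda>i. z (ks i)) \<longlonglongrightarrow> x \<and>
      (\<lambda>i. \<integral>t. (g t - Z (ks i) t)\<^sup>2 \<partial>M) \<longlonglongrightarrow> 0" for x g and ks :: "nat \<Rightarrow> nat"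
  have "\<exists>g ks. R x g ks" for x
  proof -
    have "x \<in> closure (range z)" using dense by simp
    then obtain y where y: "\<And>i. y i \<in> range z" "y \<longlonglongrightarrow> x" unfolding closure_sequential by blast
    then have "\<forall>i. \<exists>k. y i = z k" by blast
    then obtain ks where "\<And>i. y i = z (ks i)" by metis
    then have "y = (\<lambda>i. z (ks i))" by blast
    then have ks: "(\<lambda>i. z (ks i)) \<longlonglongrightarrow> x" using y(2) by simp
    have "\<exists>N. \<forall>m\<ge>N. \<forall>n\<ge>N. (\<integral>t. (Z (ks m) t - Z (ks n) t)\<^sup>2 \<partial>M) < e" if "e > 0" for e
    proof -
      have "Cauchy (\<lambda>i. z (ks i))" using ks by (rule LIMSEQ_imp_Cauchy)
      then obtain N where N: "\<And>m n. m \<ge> N \<Longrightarrow> n \<ge> N \<Longrightarrow> norm (z (ks m) - z (ks n)) < sqrt e"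
        using CauchyD[of "\<lambda>i. z (ks i)" "sqrt e"] \<open>e > 0\<close> by auto
      then have "(norm (z (ks m) - z (ks n)))\<^sup>2 < e" if "m \<ge> N" "n \<ge> N" for m n
        using power_strict_mono[OF N[OF that], of 2] \<open>e > 0\<close> by simp
      then show ?thesis unfolding dist by blast
    qed
    from L2_complete[of "\<lambda>i. Z (ks i)", OF Zs this]
    obtain g where "g \<in> square_integrable M" "(\<lambda>i. \<integral>t. (g t - Z (ks i) t)\<^sup>2 \<partial>M) \<longlonglongrightarrow> 0" .
    then show ?thesis using ks unfolding R_def by blast
  qed
  then obtain F ks where "\<And>x. R x (F x) (ks x)" by metis
  then have F: "\<And>x. F x \<in> square_integrable M" "\<And>x. (\<lambda>i. z (ks x i)) \<longlonglongrightarrow> x"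
      "\<And>x. (\<lambda>i. \<integral>t. (F x t - Z (ks x i) t)\<^sup>2 \<partial>M) \<longlonglongrightarrow> 0"
    unfolding R_def by blast+
  have FZ: "(\<integral>t. F x t * Z k t \<partial>M) = B x (z k)" for x k
  proof (rule LIMSEQ_unique)
    show "(\<lambda>i. \<integral>t. Z (ks x i) t * Z k t \<partial>M) \<longlonglongrightarrow> (\<integral>t. F x t * Z k t \<partial>M)"
      by (rule tendsto_integral_mult[OF Zs F(1) Zs F(3)])
    show "(\<lambda>i. \<integral>t. Z (ks x i) t * Z k t \<partial>M) \<longlonglongrightarrow> B x (z k)"
      unfolding ZB by (intro tendsto_form F(2) tendsto_const)
  qed
  have FF: "(\<integral>t. F x t * F y t \<partial>M) = B x y" for x y
  proof (rule LIMSEQ_unique)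
    show "(\<lambda>i. \<integral>t. Z (ks x i) t * F y t \<partial>M) \<longlonglongrightarrow> (\<integral>t. F x t * F y t \<partial>M)"
      by (rule tendsto_integral_mult[OF Zs F(1) F(1) F(3)])
    have "(\<integral>t. Z k t * F y t \<partial>M) = B (z k) y" for k
      using FZ[of y k] by (simp add: mult.commute commute)
    then show "(\<lambda>i. \<integral>t. Z (ks x i) t * F y t \<partial>M) \<longlonglongrightarrow> B x y"
      by (simp add: tendsto_form F(2) tendsto_const)
  qed
  have "AE t in M. F (z k) t = Z k t" for k
    by (rule AE_eq_of_integral_square_diff[OF F(1) Zs]) (simp add: FF FZ ZB)
  with F(1) FF that show thesis by blast
qed

end

section \<open>Finite-dimensional approximation of the operator\<close>

text \<open>Separability of the graph: for each pair of centres from a countable dense set and each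
  radius \<open>1 / Suc k\<close>, choose a point of the graph near that pair, if there is
  one.\<close>

lemma graph_dense_sequence:
  fixes A :: "'h::metric_space \<Rightarrow> 'h"
  assumes sep: "separable_space (euclidean :: 'h topology)" and ne: "D \<noteq> {}"
  obtains e :: "nat \<Rightarrow> 'h" where "range e \<subseteq> D"
    "\<And>x \<epsilon>. x \<in> D \<Longrightarrow> 0 < \<epsilon> \<Longrightarrow> \<exists>n. dist x (e n) < \<epsilon> \<and> dist (A x) (A (e n)) < \<epsilon>"
proof -
  obtain C :: "'h set" where C: "countable C" "closure C = UNIV"
    using sep by (auto simp: separable_space_def)
  obtain x0 where x0: "x0 \<in> D" using ne by blast
  define P where "P = (\<lambda>(c, d, k) x. x \<in> D \<and> dist x c < 1 / Suc k \<and> dist (A x) d < 1 / Suc k)"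
  \<comment> \<open>\<open>x0\<close> makes \<open>G\<close> nonempty, so that
    \<open>from_nat_into\<close> enumerates exactly \<open>G\<close>.\<close>
  define G where "G = insert x0 ((\<lambda>i. SOME x. P i x) ` {i \<in> C \<times> C \<times> (UNIV :: nat set). \<exists>x. P i x})"
  have "countable G"
    unfolding G_def using C(1) by (intro countable_insert countable_image countable_Collect) auto
  moreover have "G \<noteq> {}" by (simp add: G_def)
  ultimately have rG: "range (from_nat_into G) = G" by simp
  have some: "P i (SOME x. P i x)" if "\<exists>x. P i x" for i
    using that by (rule someI_ex)
  show thesis
  proof
    have PD: "x \<in> D" if "P i x" for i x using that by (auto simp: P_def)
    have "(SOME x. P i x) \<in> D" if "\<exists>x. P i x" for i
      by (rule PD[OF some[OF that]])
    then show "range (from_nat_into G) \<subseteq> D"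
      unfolding rG using x0 by (force simp: G_def)
    fix x and \<epsilon> :: real
    assume x: "x \<in> D" "0 < \<epsilon>"
    obtain k where k: "1 / Suc k < \<epsilon> / 2"
      using nat_approx_posE[of "\<epsilon> / 2"] x(2) by auto
    have "\<exists>c\<in>C. dist c y < 1 / Suc k" for y
      using closure_approachable[of y C] C(2) by simp
    then obtain c d where cd: "c \<in> C" "d \<in> C" "dist c x < 1 / Suc k" "dist d (A x) < 1 / Suc k"
      by metis
    define y where "y = (SOME x. P (c, d, k) x)"
    have "P (c, d, k) x" using cd x by (simp add: P_def dist_commute)
    then have "P (c, d, k) y" unfolding y_def by (rule someI)
    moreover have "y \<in> G" using \<open>P (c, d, k) x\<close> cd by (auto simp: G_def y_def)
    ultimately have y: "y \<in> range (from_nat_into G)" "dist y c < 1 / Suc k" "dist (A y) d < 1 / Suc k"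
      by (auto simp: P_def rG)
    have "dist x y < \<epsilon>" "dist (A x) (A y) < \<epsilon>"
      using cd(3,4) y(2,3) k dist_triangle[of x y c] dist_triangle[of "A x" "A y" d]
      by (simp_all add: dist_commute)
    then show "\<exists>n. dist x (from_nat_into G n) < \<epsilon> \<and> dist (A x) (A (from_nat_into G n)) < \<epsilon>"
      using y(1) by auto
  qed
qed

text \<open>The span need not be invariant under \<open>A\<close>, so the form
  \<open>B (A x) y\<close> on it is diagonalised instead, which amounts to the compression of
  \<open>A\<close>.\<close>

lemma (in real_inner_form) approximate_eigenbases:
  fixes e :: "nat \<Rightarrow> 'h"
  assumes D: "subspace D" and eD: "range e \<subseteq> D"
    and add: "\<And>x y. x \<in> D \<Longrightarrow> y \<in> D \<Longrightarrow> A (x + y) = A x + A y"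
    and scale: "\<And>x r. x \<in> D \<Longrightarrow> A (r *\<^sub>R x) = r *\<^sub>R A x"
    and sym: "\<And>x y. x \<in> D \<Longrightarrow> y \<in> D \<Longrightarrow> B (A x) y = B x (A y)"
  shows "\<exists>T. orthonormal T \<and> span T = span (e ` {..<n}) \<and>
    (\<forall>t\<in>T. \<exists>l. \<forall>k<n. B (A (e k)) t = l * B (e k) t)"
proof -
  have sub: "span (e ` {..<n}) \<subseteq> D"
    using eD by (intro span_minimal D) auto
  interpret V: real_inner_form_sym B "span (e ` {..<n})" "\<lambda>x y. B (A x) y"
  proof
    fix x y z r
    assume "x \<in> span (e ` {..<n})" "y \<in> span (e ` {..<n})"
    then have xy: "x \<in> D" "y \<in> D" using sub by auto
    show "B (A (x + y)) z = B (A x) z + B (A y) z" using add[OF xy] by (simp add: add_left)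
    show "B (A (r *\<^sub>R x)) y = r * B (A x) y" using scale[OF xy(1)] by (simp add: scale_left)
    show "B (A x) y = B (A y) x" using sym[OF xy] by (simp add: commute)
  qed blast
  obtain T where T: "orthonormal T" "span T = span (e ` {..<n})"
    "\<And>t. t \<in> T \<Longrightarrow> \<exists>l. \<forall>y\<in>span (e ` {..<n}). B (A t) y = l * B t y"
    by (rule V.spectral_basis) blast
  have "\<exists>l. \<forall>k<n. B (A (e k)) t = l * B (e k) t" if t: "t \<in> T" for t
  proof -
    obtain l where l: "\<And>y. y \<in> span (e ` {..<n}) \<Longrightarrow> B (A t) y = l * B t y"
      using T(3)[OF t] by blast
    have "B (A (e k)) t = l * B (e k) t" if "k < n" for k
    proof -
      have "t \<in> D" using span_base[OF t] T(2) sub by blast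
      moreover have "e k \<in> D" using eD by auto
      \<comment> \<open>As \<open>t\<close> lies in \<open>D\<close>, symmetry moves
        \<open>A\<close> from \<open>e k\<close> to \<open>t\<close>, and the eigenvector equation
        is then tested on \<open>e k\<close>.\<close>
      ultimately have "B (A (e k)) t = B (A t) (e k)" using sym by (metis commute)
      also have "\<dots> = l * B t (e k)" using that by (intro l span_base) auto
      finally show ?thesis by (simp add: commute)
    qed
    then show ?thesis by blast
  qed
  with T(1,2) show ?thesis by blast
qed

text \<open>\<open>e k\<close> lies in \<open>span (T n)\<close> once \<open>n > k\<close>, and the
  projection of \<open>x\<close> is at least as close to \<open>x\<close> as \<open>e k\<close>
  is.\<close>

lemma (in real_inner_form) tendsto_proj:
  assumes T: "\<And>n. orthonormal (T n)" "\<And>n. span (T n) = span (e ` {..<n})"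
    and dense: "closure (range e) = UNIV"
  shows "(\<lambda>n. proj (T n) x) \<longlonglongrightarrow> x"
proof (rule LIMSEQ_I)
  fix \<epsilon> :: real assume "0 < \<epsilon>"
  then obtain k where k: "dist (e k) x < \<epsilon>"
    using closure_approachable[of x "range e"] dense by auto
  have "norm (proj (T n) x - x) < \<epsilon>" if "n \<ge> Suc k" for n
  proof -
    have "e k \<in> span (T n)" unfolding T(2) using that by (intro span_base) auto
    from norm_residual_le[OF T(1) this, of x] k show ?thesis
      by (simp add: dist_norm norm_minus_commute)
  qed
  then show "\<exists>N. \<forall>n\<ge>N. norm (proj (T n) x - x) < \<epsilon>" by blast
qed

text \<open>Written as quadratic identities between coordinates, the eigenvalue relations survive
  the limit without any bound on the eigenvalues, and \<open>m\<close> is recovered from them as a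
  quotient. Density in the graph carries the relation from the \<open>e k\<close> to all of
  \<open>D\<close>.\<close>

lemma (in real_inner_form) multiplication_model:
  fixes A :: "'h \<Rightarrow> 'h"
  assumes sep: "separable_space (euclidean :: 'h topology)"
    and D: "subspace D" and dense: "closure D = UNIV"
    and add: "\<And>x y. x \<in> D \<Longrightarrow> y \<in> D \<Longrightarrow> A (x + y) = A x + A y"
    and scale: "\<And>x r. x \<in> D \<Longrightarrow> A (r *\<^sub>R x) = r *\<^sub>R A x"
    and sym: "\<And>x y. x \<in> D \<Longrightarrow> y \<in> D \<Longrightarrow> B (A x) y = B x (A y)"
  obtains M :: "real measure" and m :: "real \<Rightarrow> real" and F :: "'h \<Rightarrow> real \<Rightarrow> real"
  where "real_distribution M" "AE t in M. t \<in> {0..1}" "m \<in> borel_measurable borel"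
    "\<And>x. F x \<in> square_integrable M" "\<And>x y. (\<integral>t. F x t * F y t \<partial>M) = B x y"
    "\<And>x. x \<in> D \<Longrightarrow> AE t in M. m t * F x t = F (A x) t"
proof -
  have "D \<noteq> {}" using dense by auto
  then obtain e :: "nat \<Rightarrow> 'h" where eD: "range e \<subseteq> D"
    and e: "\<And>x \<epsilon>. x \<in> D \<Longrightarrow> 0 < \<epsilon> \<Longrightarrow> \<exists>n. dist x (e n) < \<epsilon> \<and> dist (A x) (A (e n)) < \<epsilon>"
    using graph_dense_sequence[OF sep, of D A] by metis
  have e_dense: "closure (range e) = UNIV"
  proof -
    have "D \<subseteq> closure (range e)"
      using e unfolding closure_approachable subset_iff by (metis dist_commute rangeI)
    then show ?thesis using closure_minimal[of D "closure (range e)"] dense by auto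
  qed
  obtain T where T: "\<And>n. orthonormal (T n)" "\<And>n. span (T n) = span (e ` {..<n})"
    and eig: "\<And>n t. t \<in> T n \<Longrightarrow> \<exists>l. \<forall>k<n. B (A (e k)) t = l * B (e k) t"
    using approximate_eigenbases[OF D eD add scale sym] by metis
  \<comment> \<open>Interleaving vectors and images lets one limit treat both, including their mixed
    inner products.\<close>
  define z where "z k = (if even k then e (k div 2) else A (e (k div 2)))" for k
  have z_even: "z (2 * k) = e k" and z_odd: "z (Suc (2 * k)) = A (e k)" for k
    by (auto simp: z_def)
  have "range e \<subseteq> range z"
    using z_even by (metis image_subsetI rangeI)
  then have z_dense: "closure (range z) = UNIV"
    using closure_mono e_dense by blast
  obtain M :: "real measure" and Z where M: "real_distribution M" and M01: "AE t in M. t \<in> {0..1}"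
    and Zm [measurable]: "\<And>k. Z k \<in> borel_measurable borel" and Zs: "\<And>k. Z k \<in> square_integrable M"
    and ZB: "\<And>j k. (\<integral>t. Z j t * Z k t \<partial>M) = B (z j) (z k)"
    and ZQ: "\<And>i j k l. (\<forall>\<^sub>F n in sequentially. \<forall>t\<in>T n. B (z i) t * B (z j) t = B (z k) t * B (z l) t)
      \<longrightarrow> (AE t in M. Z i t * Z j t = Z k t * Z l t)"
    by (rule limit_of_orthonormal_systems[of T z, OF T(1) tendsto_proj[OF T e_dense]]) blast
  interpret real_distribution M by fact
  obtain F where Fs: "\<And>x. F x \<in> square_integrable M" and FB: "\<And>x y. (\<integral>t. F x t * F y t \<partial>M) = B x y"
    and FZ: "\<And>k. AE t in M. F (z k) t = Z k t"
    by (rule isometric_extension[of M z Z, OF prob_space_axioms z_dense Zs ZB]) blast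
  have [measurable]: "F x \<in> borel_measurable borel" for x
    using square_integrableD(1)[OF Fs[of x]] by simp
  have F_dist: "(\<integral>t. (F x t - F y t)\<^sup>2 \<partial>M) = (norm (x - y))\<^sup>2" for x y
    by (simp add: integral_diff_square Fs FB norm_diff_square self)
  define h g where "h k = Z (2 * k)" and "g k = Z (Suc (2 * k))" for k
  have [measurable]: "h k \<in> borel_measurable borel" "g k \<in> borel_measurable borel" for k
    by (auto simp: h_def g_def)
  have Fh: "AE t in M. F (e k) t = h k t" and Fg: "AE t in M. F (A (e k)) t = g k t" for k
    using FZ[of "2 * k"] FZ[of "Suc (2 * k)"] by (simp_all add: h_def g_def z_even z_odd)
  \<comment> \<open>On an eigenvector with eigenvalue \<open>l\<close> both sides are
    \<open>l * B (e j) t * B (e k) t\<close>; the identity itself mentions neither \<open>l\<close>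
    nor a division.\<close>
  have rel: "AE t in M. g j t * h k t = g k t * h j t" for j k
  proof -
    have "\<forall>\<^sub>F n in sequentially. \<forall>t\<in>T n.
        B (z (Suc (2 * j))) t * B (z (2 * k)) t = B (z (Suc (2 * k))) t * B (z (2 * j)) t"
    proof (rule eventually_sequentiallyI, rule ballI)
      fix n t assume n: "Suc (max j k) \<le> n" and t: "t \<in> T n"
      from eig[OF t] obtain l where "\<forall>k<n. B (A (e k)) t = l * B (e k) t" by blast
      with n show "B (z (Suc (2 * j))) t * B (z (2 * k)) t = B (z (Suc (2 * k))) t * B (z (2 * j)) t"
        by (simp add: z_even z_odd)
    qed
    then show ?thesis using ZQ unfolding h_def g_def by blast
  qed
  \<comment> \<open>The limit measure may charge points with \<open>m = \<infinity>\<close>, but the range of \<open>F\<close> does not see them.\<close>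
  have vanish: "AE t in M. (\<forall>k. h k t = 0) \<longrightarrow> F y t = 0" for y
  proof -
    define I where "I t = (if \<forall>k. h k t = 0 then F y t else 0)" for t
    have [measurable]: "I \<in> borel_measurable borel" unfolding I_def by measurable
    have Is: "integrable M (\<lambda>t. (I t)\<^sup>2)"
      by (rule Bochner_Integration.integrable_bound[OF square_integrable_real_square[OF Fs[of y]]])
        (auto simp: I_def)
    have "(\<integral>t. (I t)\<^sup>2 \<partial>M) \<le> \<epsilon>" if \<epsilon>: "0 < \<epsilon>" for \<epsilon>
    proof -
      have "\<forall>\<epsilon>>0. \<exists>k. dist (e k) y < \<epsilon>"
        using closure_approachable[of y "range e"] e_dense by auto
      then obtain k where "dist (e k) y < sqrt \<epsilon>"
        using real_sqrt_gt_zero[OF \<epsilon>] by blast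
      then have k: "(norm (y - e k))\<^sup>2 \<le> \<epsilon>"
        using power_strict_mono[of "norm (y - e k)" "sqrt \<epsilon>" 2] \<epsilon>
        by (simp add: dist_norm norm_minus_commute)
      \<comment> \<open>Where \<open>I\<close> is nonzero, \<open>F (e k)\<close> is 0 almost
        everywhere, so there \<open>I\<close> is the difference of \<open>F y\<close> and
        \<open>F (e k)\<close>.\<close>
      have "(\<integral>t. (I t)\<^sup>2 \<partial>M) \<le> (\<integral>t. (F y t - F (e k) t)\<^sup>2 \<partial>M)"
      proof (rule integral_mono_AE[OF Is])
        show "integrable M (\<lambda>t. (F y t - F (e k) t)\<^sup>2)"
          by (intro square_integrable_real_square square_integrable_diff Fs)
        show "AE t in M. (I t)\<^sup>2 \<le> (F y t - F (e k) t)\<^sup>2"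
          using Fh[of k] by eventually_elim (auto simp: I_def)
      qed
      then show ?thesis using k by (simp add: F_dist)
    qed
    then have "(\<integral>t. (I t)\<^sup>2 \<partial>M) \<le> 0" by (rule field_le_epsilon[of _ 0, simplified])
    moreover have "0 \<le> (\<integral>t. (I t)\<^sup>2 \<partial>M)" by simp
    ultimately have "(\<integral>t. (I t)\<^sup>2 \<partial>M) = 0" by (rule antisym)
    then have "AE t in M. (I t)\<^sup>2 = 0"
      by (subst (asm) integral_nonneg_eq_0_iff_AE[OF Is]) auto
    then show ?thesis by eventually_elim (auto simp: I_def split: if_splits)
  qed
  \<comment> \<open>If all \<open>h k t\<close> vanish then \<open>LEAST\<close> is arbitrary, but the division yields \<open>0\<close>.\<close>
  define m where "m t = g (LEAST k. h k t \<noteq> 0) t / h (LEAST k. h k t \<noteq> 0) t" for t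
  \<comment> \<open>The index chosen by \<open>LEAST\<close> depends measurably on \<open>t\<close>
    and has countably many values.\<close>
  have mm [measurable]: "m \<in> borel_measurable borel"
    unfolding m_def
    by (rule measurable_compose_countable[where f = "\<lambda>i t. g i t / h i t"]) measurable
  have m_e: "AE t in M. m t * F (e k) t = F (A (e k)) t" for k
  proof -
    have "AE t in M. \<forall>j. g j t * h k t = g k t * h j t"
      unfolding AE_all_countable using rel by blast
    \<comment> \<open>Where all \<open>h\<close> are 0, \<open>F (e k)\<close> equals
      \<open>h k = 0\<close>, and \<open>vanish\<close> makes \<open>F (A (e k))\<close> 0 as
      well.\<close>
    with Fh[of k] Fg[of k] vanish[of "A (e k)"] show ?thesis
    proof eventually_elim
      case (elim t)
      show ?case
      proof (cases "\<forall>k. h k t = 0")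
        case False
        then have "h (LEAST k. h k t \<noteq> 0) t \<noteq> 0" by (metis (mono_tags, lifting) LeastI)
        moreover have "g (LEAST k. h k t \<noteq> 0) t * h k t = g k t * h (LEAST k. h k t \<noteq> 0) t"
          using elim by blast
        ultimately have "m t * h k t = g k t"
          unfolding m_def by (simp add: divide_eq_eq)
        then show ?thesis using elim by simp
      qed (use elim in simp)
    qed
  qed
  have "AE t in M. m t * F x t = F (A x) t" if x: "x \<in> D" for x
  proof -
    \<comment> \<open>Dividing by \<open>1 + \<bar>m\<bar>\<close> makes multiplication by \<open>m\<close> bounded, so that \<open>e k \<rightarrow> x\<close> passes to the limit.\<close>
    define q where "q t = \<bar>m t * F x t - F (A x) t\<bar> / (1 + \<bar>m t\<bar>)" for t
    have [measurable]: "q \<in> borel_measurable borel" unfolding q_def by measurable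
    have i: "integrable M (\<lambda>t. \<bar>F x t - F y t\<bar>)" "(\<integral>t. \<bar>F x t - F y t\<bar> \<partial>M) \<le> norm (x - y)" for x y
      using integral_abs_le_L2[OF square_integrable_diff[OF Fs Fs], of x y] by (simp_all add: F_dist)
    have q_le: "AE t in M. q t \<le> \<bar>F x t - F (e k) t\<bar> + \<bar>F (A x) t - F (A (e k)) t\<bar>" for k
      using m_e[of k]
    proof eventually_elim
      case (elim t)
      have "m t * F x t - F (A x) t
          = m t * (F x t - F (e k) t) - (F (A x) t - F (A (e k)) t)"
        using elim by (simp add: algebra_simps)
      then have "\<bar>m t * F x t - F (A x) t\<bar>
          \<le> \<bar>m t\<bar> * \<bar>F x t - F (e k) t\<bar> + \<bar>F (A x) t - F (A (e k)) t\<bar>"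
        by (metis abs_mult abs_triangle_ineq4)
      also have "\<dots> \<le> (1 + \<bar>m t\<bar>) * (\<bar>F x t - F (e k) t\<bar> + \<bar>F (A x) t - F (A (e k)) t\<bar>)"
        by (simp add: algebra_simps add_increasing)
      finally show ?case
        by (simp add: q_def pos_divide_le_eq mult.commute add_pos_nonneg)
    qed
    have q0: "0 \<le> q t" for t by (simp add: q_def)
    have qi: "integrable M q"
      by (rule Bochner_Integration.integrable_bound[OF
            Bochner_Integration.integrable_add[OF i(1)[of x "e 0"] i(1)[of "A x" "A (e 0)"]]])
        (use q_le[of 0] q0 in auto)
    have "(\<integral>t. q t \<partial>M) \<le> \<epsilon>" if "0 < \<epsilon>" for \<epsilon>
    proof -
      \<comment> \<open>Density in the graph gives one \<open>k\<close> for both estimates.\<close>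
      obtain k where k: "dist x (e k) < \<epsilon> / 2" "dist (A x) (A (e k)) < \<epsilon> / 2"
        using e[OF x, of "\<epsilon> / 2"] \<open>0 < \<epsilon>\<close> by auto
      have "(\<integral>t. q t \<partial>M) \<le> (\<integral>t. \<bar>F x t - F (e k) t\<bar> + \<bar>F (A x) t - F (A (e k)) t\<bar> \<partial>M)"
        using q_le i by (intro integral_mono_AE qi) auto
      also have "\<dots> \<le> norm (x - e k) + norm (A x - A (e k))"
        using i by (simp add: add_mono)
      finally show ?thesis using k by (simp add: dist_norm)
    qed
    then have "(\<integral>t. q t \<partial>M) \<le> 0" by (rule field_le_epsilon[of _ 0, simplified])
    moreover have "0 \<le> (\<integral>t. q t \<partial>M)" using q0 by simp
    ultimately have "(\<integral>t. q t \<partial>M) = 0" by (rule antisym)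
    then have "AE t in M. q t = 0"
      by (subst (asm) integral_nonneg_eq_0_iff_AE[OF qi]) (auto simp: q0)
    then show ?thesis
    proof eventually_elim
      case (elim t)
      moreover have "1 + \<bar>m t\<bar> \<noteq> 0" by linarith
      ultimately show ?case by (simp add: q_def)
    qed
  qed
  then show thesis by (rule that[OF M M01 mm Fs FB])
qed

subsection \<open>Multiplication operators\<close>

lemma to_complex_of_real [simp]: "to_complex (of_real r :: 'k::rc_scalar) = of_real r"
  by (simp add: of_real_def to_complex_scaleR to_complex_one)

lemma to_complex_minus: "to_complex (- a :: 'k::rc_scalar) = - to_complex a"
  using to_complex_scaleR[of "-1" a] by simp

lemma to_complex_diff: "to_complex (a - b :: 'k::rc_scalar) = to_complex a - to_complex b"
  using to_complex_add[of a "-b"] by (simp add: to_complex_minus)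

text \<open>\<open>to_complex\<close> is additive and preserves the norm, hence is injective;
  identities in K can thus be checked in the complex numbers.\<close>

lemma to_complex_eqI: "to_complex a = to_complex b \<Longrightarrow> a = (b :: 'k::rc_scalar)"
  using norm_to_complex[of "a - b"] by (simp add: to_complex_diff)

lemma rc_cnj_add: "rc_cnj (a + b :: 'k::rc_scalar) = rc_cnj a + rc_cnj b"
  by (rule to_complex_eqI) (simp add: to_complex_rc_cnj to_complex_add)

lemma rc_cnj_diff: "rc_cnj (a - b :: 'k::rc_scalar) = rc_cnj a - rc_cnj b"
  by (rule to_complex_eqI) (simp add: to_complex_rc_cnj to_complex_diff)

lemma rc_cnj_mult: "rc_cnj (a * b :: 'k::rc_scalar) = rc_cnj a * rc_cnj b"
  by (rule to_complex_eqI) (simp add: to_complex_rc_cnj to_complex_mult)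

lemma rc_cnj_of_real [simp]: "rc_cnj (of_real r :: 'k::rc_scalar) = of_real r"
  by (rule to_complex_eqI) (simp add: to_complex_rc_cnj)

lemma norm_rc_cnj [simp]: "norm (rc_cnj a) = norm (a :: 'k::rc_scalar)"
  by (metis complex_mod_cnj norm_to_complex to_complex_rc_cnj)

lemma mult_rc_cnj: "a * rc_cnj a = of_real ((norm (a :: 'k::rc_scalar))\<^sup>2)"
proof -
  have "to_complex (a * rc_cnj a) = of_real ((norm (to_complex a))\<^sup>2)"
    by (simp only: to_complex_mult to_complex_rc_cnj complex_norm_square)
  then have "to_complex (a * rc_cnj a) = to_complex (of_real ((norm a)\<^sup>2) :: 'k)"
    by (simp only: norm_to_complex to_complex_of_real)
  then show ?thesis by (rule to_complex_eqI)
qed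

lemma bounded_linear_rc_cnj: "bounded_linear (rc_cnj :: 'k::rc_scalar \<Rightarrow> 'k)"
proof (rule bounded_linear_intro[where K = 1])
  show "rc_cnj (r *\<^sub>R a) = r *\<^sub>R rc_cnj a" for r and a :: 'k
    by (simp add: scaleR_conv_of_real rc_cnj_mult)
qed (simp_all add: rc_cnj_add)

lemma borel_measurable_rc_cnj [measurable]:
  "rc_cnj \<in> borel_measurable (borel :: 'k::rc_scalar measure)"
  by (intro borel_measurable_continuous_onI linear_continuous_on bounded_linear_rc_cnj)

lemma square_integrable_rc_cnj:
  fixes f :: "'a \<Rightarrow> 'k::rc_scalar"
  assumes "f \<in> square_integrable M"
  shows "(\<lambda>x. rc_cnj (f x)) \<in> square_integrable M"
  using assms by (auto simp: square_integrable_def)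

lemma square_integrable_cong_AE:
  fixes f g :: "'a \<Rightarrow> 'k::rc_scalar"
  assumes "f \<in> square_integrable M" "g \<in> borel_measurable M" "AE x in M. g x = f x"
  shows "g \<in> square_integrable M"
  using assms(2) square_integrableD(2)[OF assms(1)]
  by (rule square_integrable_bound) (use assms(3) in eventually_elim, simp)

section \<open>Classes of square-integrable functions\<close>

lemma L2_class_in_L2: "f \<in> square_integrable M \<Longrightarrow> L2_class M f \<in> L2 M"
  by (auto simp: L2_def L2_class_def intro: quotientI)

lemma L2_class_rep:
  assumes "F \<in> L2 M"
  shows "L2_class M (L2_rep F) = F"
proof -
  obtain f where f: "f \<in> square_integrable M" "F = L2_class M f"
    using assms by (auto simp: L2_def L2_class_def elim: quotientE)
  then show ?thesis
    using AE_L2_rep_class[OF f(1)] L2_rep_square_integrable[OF assms] by (simp add: L2_class_eq_iff)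
qed

lemma L2_norm_class:
  assumes "f \<in> square_integrable M"
  shows "L2_norm M (L2_class M f) = sqrt (\<integral>x. (norm (f x))\<^sup>2 \<partial>M)"
proof -
  have [measurable]: "f \<in> borel_measurable M" "L2_rep (L2_class M f) \<in> borel_measurable M"
    using square_integrableD(1)[OF assms]
      square_integrableD(1)[OF L2_rep_square_integrable[OF L2_class_in_L2[OF assms]]] by auto
  show ?thesis
    unfolding L2_norm_def using AE_L2_rep_class[OF assms]
    by (intro arg_cong[where f = sqrt] integral_cong_AE) auto
qed

lemma L2_class_cong:
  assumes "f \<in> square_integrable M" "g \<in> square_integrable M" "AE x in M. f x = g x"
  shows "L2_class M f = L2_class M g"
  using assms by (simp add: L2_class_eq_iff)

section \<open>Self-adjointness of multiplication by a real function\<close>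

context
  fixes M :: "'a measure" and m :: "'a \<Rightarrow> real"
  assumes m [measurable]: "m \<in> borel_measurable M"
begin

text \<open>The definitions refer to the chosen representative of a class; with this lemma any
  representative can be used.\<close>

lemma L2_class_in_mult_dom:
  fixes f :: "'a \<Rightarrow> 'k::rc_scalar"
  assumes f: "f \<in> square_integrable M" and mf: "(\<lambda>x. of_real (m x) * f x) \<in> square_integrable M"
  shows "L2_class M f \<in> mult_dom M m"
    and "mult_op M m (L2_class M f) = L2_class M (\<lambda>x. of_real (m x) * f x)"
proof -
  have [measurable]: "L2_rep (L2_class M f) \<in> borel_measurable M"
    using L2_rep_square_integrable[OF L2_class_in_L2[OF f]] by (rule square_integrableD)
  have AE: "AE x in M. of_real (m x) * L2_rep (L2_class M f) x = of_real (m x) * f x"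
    using AE_L2_rep_class[OF f] by eventually_elim simp
  have s: "(\<lambda>x. of_real (m x) * L2_rep (L2_class M f) x) \<in> square_integrable M"
    by (rule square_integrable_cong_AE[OF mf _ AE]) measurable
  then show "L2_class M f \<in> mult_dom M m"
    by (simp add: mult_dom_def L2_class_in_L2 f)
  show "mult_op M m (L2_class M f) = L2_class M (\<lambda>x. of_real (m x) * f x)"
    unfolding mult_op_def by (rule L2_class_cong[OF s mf AE])
qed

text \<open>Indicator of the set where multiplication by \<open>m\<close> is bounded by
  \<open>n\<close>; as \<open>m\<close> is finite everywhere, these sets exhaust the space.\<close>

definition cutoff :: "nat \<Rightarrow> 'a \<Rightarrow> real"
  where "cutoff n x = (if \<bar>m x\<bar> \<le> real n then 1 else 0)"

lemma cutoff_measurable [measurable]: "cutoff n \<in> borel_measurable M"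
  unfolding cutoff_def by measurable

text \<open>Two functions \<open>g\<close> and \<open>h\<close> in the bound allow for
  \<open>m g - h\<close> in the adjoint argument, where \<open>m g\<close> is not yet known to be
  square-integrable.\<close>

lemma square_integrable_cutoff:
  fixes f :: "'a \<Rightarrow> 'k::rc_scalar"
  assumes [measurable]: "f \<in> borel_measurable M"
    and "g \<in> square_integrable M" "h \<in> square_integrable M"
    and le: "\<And>x. norm (f x) \<le> \<bar>m x\<bar> * norm (g x) + norm (h x)"
  shows "(\<lambda>x. of_real (cutoff n x) * f x) \<in> square_integrable M"
proof (rule square_integrable_bound)
  show "integrable M (\<lambda>x. 2 * ((real n)\<^sup>2 * (norm (g x))\<^sup>2) + 2 * (norm (h x))\<^sup>2)"
    using square_integrableD(2)[OF assms(2)] square_integrableD(2)[OF assms(3)] by auto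
  show "AE x in M. (norm (of_real (cutoff n x) * f x))\<^sup>2
      \<le> 2 * ((real n)\<^sup>2 * (norm (g x))\<^sup>2) + 2 * (norm (h x))\<^sup>2"
  proof (rule AE_I2)
    fix x
    show "(norm (of_real (cutoff n x) * f x))\<^sup>2
        \<le> 2 * ((real n)\<^sup>2 * (norm (g x))\<^sup>2) + 2 * (norm (h x))\<^sup>2"
    proof (cases "\<bar>m x\<bar> \<le> real n")
      case True
      have "norm (f x) \<le> real n * norm (g x) + norm (h x)"
        using le[of x] True by (meson add_right_mono mult_right_mono norm_ge_zero order_trans)
      then have "(norm (f x))\<^sup>2 \<le> (real n * norm (g x) + norm (h x))\<^sup>2"
        by (intro power_mono) auto
      also have "\<dots> \<le> 2 * (real n * norm (g x))\<^sup>2 + 2 * (norm (h x))\<^sup>2"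
        using norm_add_square_le[of "real n * norm (g x)" "norm (h x)"] by simp
      finally show ?thesis using True by (simp add: cutoff_def power_mult_distrib)
    qed (simp add: cutoff_def)
  qed
qed measurable

lemma square_integrable_cutoff_mult:
  fixes f :: "'a \<Rightarrow> 'k::rc_scalar"
  assumes "f \<in> square_integrable M"
  shows "(\<lambda>x. of_real (cutoff n x) * (of_real (m x) * f x)) \<in> square_integrable M"
proof -
  have [measurable]: "f \<in> borel_measurable M" using assms by (rule square_integrableD)
  show ?thesis
    by (rule square_integrable_cutoff[where g = f and h = f]) (use assms in \<open>auto simp: norm_mult\<close>)
qed

lemma square_integrable_cutoff':
  fixes f :: "'a \<Rightarrow> 'k::rc_scalar"
  assumes "f \<in> square_integrable M"
  shows "(\<lambda>x. of_real (cutoff n x) * f x) \<in> square_integrable M"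
  by (rule square_integrable_cutoff[where g = f and h = f])
    (use assms in \<open>auto intro: square_integrableD\<close>)

text \<open>The truncations of a function to the sets \<open>\<bar>m x\<bar> \<le> n\<close> lie in
  the domain and converge to it by dominated convergence.\<close>

lemma L2_dense_mult_dom: "L2_dense M (mult_dom M m :: ('a \<Rightarrow> 'k::rc_scalar) set set)"
  unfolding L2_dense_def
proof (intro conjI ballI allI impI)
  fix F :: "('a \<Rightarrow> 'k) set" and e :: real
  assume F: "F \<in> L2 M" and e: "0 < e"
  define f where "f = L2_rep F"
  have f: "f \<in> square_integrable M" unfolding f_def by (rule L2_rep_square_integrable[OF F])
  have [measurable]: "f \<in> borel_measurable M" using f by (rule square_integrableD)
  define u where "u n x = of_real (cutoff n x) * f x" for n x
  have u: "u n \<in> square_integrable M" for n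
    unfolding u_def by (rule square_integrable_cutoff'[OF f])
  have [measurable]: "u n \<in> borel_measurable M" for n using u by (rule square_integrableD)
  have "(\<lambda>n. \<integral>x. (norm (f x - u n x))\<^sup>2 \<partial>M) \<longlonglongrightarrow> (\<integral>x. 0 \<partial>M)"
  proof (rule integral_dominated_convergence)
    show "integrable M (\<lambda>x. (norm (f x))\<^sup>2)" using f by (rule square_integrableD)
    show "AE x in M. (\<lambda>n. (norm (f x - u n x))\<^sup>2) \<longlonglongrightarrow> 0"
    proof (intro AE_I2 tendsto_eventually eventually_sequentiallyI)
      fix x n
      assume "nat \<lceil>\<bar>m x\<bar>\<rceil> \<le> n"
      then have "\<bar>m x\<bar> \<le> real n" by linarith
      then show "(norm (f x - u n x))\<^sup>2 = 0" by (simp add: u_def cutoff_def)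
    qed
    show "AE x in M. norm ((norm (f x - u n x))\<^sup>2) \<le> (norm (f x))\<^sup>2" for n
      by (intro AE_I2) (simp add: u_def cutoff_def)
  qed measurable
  then have "\<forall>\<^sub>F n in sequentially. (\<integral>x. (norm (f x - u n x))\<^sup>2 \<partial>M) < e\<^sup>2"
    using e by (intro order_tendstoD(2)[where y = 0]) auto
  then obtain n where n: "(\<integral>x. (norm (f x - u n x))\<^sup>2 \<partial>M) < e\<^sup>2"
    unfolding eventually_sequentially by blast
  define G where "G = L2_class M (u n)"
  have "G \<in> mult_dom M m"
    unfolding G_def using square_integrable_cutoff_mult[OF f, of n]
    by (intro L2_class_in_mult_dom u) (simp add: u_def mult.left_commute)
  moreover have "L2_norm M (L2_diff M F G) < e"
  proof -
    have fu: "(\<lambda>x. f x - u n x) \<in> square_integrable M"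
      by (rule square_integrable_diff[OF f u])
    have G: "L2_rep G \<in> square_integrable M"
      unfolding G_def by (intro L2_rep_square_integrable L2_class_in_L2 u)
    have "L2_diff M F G = L2_class M (\<lambda>x. f x - u n x)"
      unfolding L2_diff_def f_def[symmetric]
    proof (rule L2_class_cong[OF square_integrable_diff[OF f G] fu])
      show "AE x in M. f x - L2_rep G x = f x - u n x"
        using AE_L2_rep_class[OF u, of n] unfolding G_def by eventually_elim simp
    qed
    then have "L2_norm M (L2_diff M F G) = sqrt (\<integral>x. (norm (f x - u n x))\<^sup>2 \<partial>M)"
      by (simp add: L2_norm_class[OF fu])
    also have "\<dots> < sqrt (e\<^sup>2)" using n by (rule real_sqrt_less_mono)
    finally show ?thesis using e by simp
  qed
  ultimately show "\<exists>G\<in>mult_dom M m. L2_norm M (L2_diff M F G) < e" by blast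
qed (auto simp: mult_dom_def)

lemma L2_inner_class_left:
  fixes f :: "'a \<Rightarrow> 'k::rc_scalar"
  assumes f: "f \<in> square_integrable M" and G: "G \<in> L2 M"
  shows "L2_inner M (L2_class M f) G = (\<integral>x. f x * rc_cnj (L2_rep G x) \<partial>M)"
proof -
  have [measurable]: "f \<in> borel_measurable M" "L2_rep G \<in> borel_measurable M"
    "L2_rep (L2_class M f) \<in> borel_measurable M"
    using square_integrableD(1)[OF f] square_integrableD(1)[OF L2_rep_square_integrable[OF G]]
      square_integrableD(1)[OF L2_rep_square_integrable[OF L2_class_in_L2[OF f]]] by auto
  show ?thesis
    unfolding L2_inner_def
    by (rule integral_cong_AE) (use AE_L2_rep_class[OF f] in \<open>measurable, auto\<close>)
qed

text \<open>\<open>m\<close> is real, so \<open>of_real (m x)\<close> is its own conjugate and moves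
  to the other factor.\<close>

lemma mult_op_symmetric:
  fixes F G :: "('a \<Rightarrow> 'k::rc_scalar) set"
  assumes "F \<in> mult_dom M m" "G \<in> mult_dom M m"
  shows "L2_inner M (mult_op M m F) G = L2_inner M F (mult_op M m G)"
proof -
  have F: "F \<in> L2 M" "(\<lambda>x. of_real (m x) * L2_rep F x) \<in> square_integrable M"
    and G: "G \<in> L2 M" "(\<lambda>x. of_real (m x) * L2_rep G x) \<in> square_integrable M"
    using assms by (auto simp: mult_dom_def)
  have [measurable]: "L2_rep F \<in> borel_measurable M" "L2_rep G \<in> borel_measurable M"
    "L2_rep (mult_op M m G) \<in> borel_measurable M"
    using square_integrableD(1)[OF L2_rep_square_integrable] F(1) G(1)
      L2_class_in_L2[OF G(2)] unfolding mult_op_def by blast+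
  have "L2_inner M (mult_op M m F) G = (\<integral>x. of_real (m x) * L2_rep F x * rc_cnj (L2_rep G x) \<partial>M)"
    unfolding mult_op_def by (rule L2_inner_class_left[OF F(2) G(1)])
  also have "\<dots> = L2_inner M F (mult_op M m G)"
    unfolding L2_inner_def
  proof (rule integral_cong_AE)
    show "AE x in M. of_real (m x) * L2_rep F x * rc_cnj (L2_rep G x)
        = L2_rep F x * rc_cnj (L2_rep (mult_op M m G) x)"
      using AE_L2_rep_class[OF G(2)] unfolding mult_op_def
      by eventually_elim (simp add: rc_cnj_mult)
  qed measurable
  finally show ?thesis .
qed

text \<open>With \<open>g\<close> and \<open>h\<close> representing \<open>G\<close> and
  \<open>H\<close>, test the adjoint relation on the truncation of \<open>m g - h\<close> to
  \<open>\<bar>m x\<bar> \<le> n\<close>. This shows that the truncation has norm 0, so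
  \<open>m g = h\<close> almost everywhere on each of these sets.\<close>

lemma mult_op_adjoint_subset:
  fixes G H :: "('a \<Rightarrow> 'k::rc_scalar) set"
  assumes "(G, H) \<in> L2_adjoint_graph M (mult_dom M m) (mult_op M m)"
  shows "G \<in> mult_dom M m" and "H = mult_op M m G"
proof -
  have G: "G \<in> L2 M" and H: "H \<in> L2 M"
    and adj: "\<And>F. F \<in> mult_dom M m \<Longrightarrow> L2_inner M (mult_op M m F) G = L2_inner M F H"
    using assms by (auto simp: L2_adjoint_graph_def)
  define g h where "g = L2_rep G" and "h = L2_rep H"
  have g: "g \<in> square_integrable M" and h: "h \<in> square_integrable M"
    unfolding g_def h_def by (rule L2_rep_square_integrable[OF G] L2_rep_square_integrable[OF H])+
  have [measurable]: "g \<in> borel_measurable M" "h \<in> borel_measurable M"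
    using square_integrableD(1)[OF g] square_integrableD(1)[OF h] by auto
  define w where "w x = of_real (m x) * g x - h x" for x
  have [measurable]: "w \<in> borel_measurable M" unfolding w_def by measurable
  have w_le: "norm (w x) \<le> \<bar>m x\<bar> * norm (g x) + norm (h x)" for x
    unfolding w_def by (metis norm_mult norm_of_real norm_triangle_ineq4)
  have w0: "AE x in M. \<bar>m x\<bar> \<le> real n \<longrightarrow> w x = 0" for n
  proof -
    define u where "u x = of_real (cutoff n x) * w x" for x
    have u: "u \<in> square_integrable M"
      unfolding u_def by (rule square_integrable_cutoff[OF _ g h w_le]) measurable
    have mu: "(\<lambda>x. of_real (m x) * u x) \<in> square_integrable M"
    proof -
      have "(\<lambda>x. of_real (cutoff n x) * (of_real (m x) * u x)) \<in> square_integrable M"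
        by (rule square_integrable_cutoff_mult[OF u])
      moreover have "of_real (cutoff n x) * (of_real (m x) * u x) = of_real (m x) * u x" for x
        by (simp add: u_def cutoff_def)
      ultimately show ?thesis by simp
    qed
    have i1: "integrable M (\<lambda>x. of_real (m x) * u x * rc_cnj (g x))"
      and i2: "integrable M (\<lambda>x. u x * rc_cnj (h x))"
      by (intro square_integrable_mult square_integrable_rc_cnj g h u mu)+
    have "(\<integral>x. of_real (m x) * u x * rc_cnj (g x) \<partial>M) = (\<integral>x. u x * rc_cnj (h x) \<partial>M)"
      using adj[OF L2_class_in_mult_dom(1)[OF u mu]]
      unfolding L2_class_in_mult_dom(2)[OF u mu] L2_inner_class_left[OF mu G]
        L2_inner_class_left[OF u H] g_def h_def .
    then have "0 = (\<integral>x. of_real (m x) * u x * rc_cnj (g x) - u x * rc_cnj (h x) \<partial>M)"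
      using i1 i2 by simp
    also have "\<dots> = (\<integral>x. of_real ((norm (u x))\<^sup>2) \<partial>M)"
    proof (rule Bochner_Integration.integral_cong[OF refl])
      fix x
      have "of_real (m x) * u x * rc_cnj (g x) - u x * rc_cnj (h x) = u x * rc_cnj (w x)"
        by (simp add: w_def rc_cnj_diff rc_cnj_mult algebra_simps)
      \<comment> \<open>The cutoff takes only the values 0 and 1, so next to a factor
        \<open>u\<close> the function \<open>w\<close> may be replaced by \<open>u\<close>.\<close>
      also have "\<dots> = u x * rc_cnj (u x)" by (simp add: u_def cutoff_def)
      also have "\<dots> = of_real ((norm (u x))\<^sup>2)" by (rule mult_rc_cnj)
      finally show "of_real (m x) * u x * rc_cnj (g x) - u x * rc_cnj (h x)
          = (of_real ((norm (u x))\<^sup>2) :: 'k)" .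
    qed
    also have "\<dots> = of_real (\<integral>x. (norm (u x))\<^sup>2 \<partial>M)"
      by (rule integral_bounded_linear[OF bounded_linear_of_real square_integrableD(2)[OF u]])
    finally have "(\<integral>x. (norm (u x))\<^sup>2 \<partial>M) = 0" by (metis of_real_eq_0_iff)
    then have "AE x in M. (norm (u x))\<^sup>2 = 0"
      by (subst (asm) integral_nonneg_eq_0_iff_AE[OF square_integrableD(2)[OF u]]) auto
    then show ?thesis by eventually_elim (auto simp: u_def cutoff_def)
  qed
  have AE: "AE x in M. of_real (m x) * g x = h x"
  proof -
    have "AE x in M. \<forall>n. \<bar>m x\<bar> \<le> real n \<longrightarrow> w x = 0" unfolding AE_all_countable using w0 by blast
    then show ?thesis
    proof eventually_elim
      case (elim x)
      have "\<bar>m x\<bar> \<le> real (nat \<lceil>\<bar>m x\<bar>\<rceil>)" by linarith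
      then have "w x = 0" using elim by blast
      then show ?case by (simp add: w_def)
    qed
  qed
  have mg: "(\<lambda>x. of_real (m x) * g x) \<in> square_integrable M"
    by (rule square_integrable_cong_AE[OF h _ AE]) measurable
  then show "G \<in> mult_dom M m" using G by (simp add: mult_dom_def g_def)
  have "mult_op M m G = L2_class M h"
    unfolding mult_op_def g_def[symmetric] by (rule L2_class_cong[OF mg h AE])
  then show "H = mult_op M m G" by (simp add: h_def L2_class_rep[OF H])
qed

lemma L2_self_adjoint_mult_op:
  "L2_self_adjoint M (mult_dom M m :: ('a \<Rightarrow> 'k::rc_scalar) set set) (mult_op M m)"
  unfolding L2_self_adjoint_def
proof (intro conjI L2_dense_mult_dom subset_antisym subsetI)
  fix p :: "('a \<Rightarrow> 'k) set \<times> ('a \<Rightarrow> 'k) set"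
  assume "p \<in> L2_adjoint_graph M (mult_dom M m) (mult_op M m)"
  then show "p \<in> {(F, mult_op M m F) | F. F \<in> mult_dom M m}"
    using mult_op_adjoint_subset by (cases p) blast
next
  fix p :: "('a \<Rightarrow> 'k) set \<times> ('a \<Rightarrow> 'k) set"
  assume "p \<in> {(F, mult_op M m F) | F. F \<in> mult_dom M m}"
  then obtain G where G: "G \<in> mult_dom M m" "p = (G, mult_op M m G)" by blast
  then have "G \<in> L2 M" "mult_op M m G \<in> L2 M"
    by (auto simp: mult_dom_def mult_op_def intro: L2_class_in_L2)
  then show "p \<in> L2_adjoint_graph M (mult_dom M m) (mult_op M m)"
    using G mult_op_symmetric by (auto simp: L2_adjoint_graph_def)
qed

end

subsection \<open>From the unit interval to the space of points\<close>

text \<open>The constant sequences with value in [0, 1] are a copy of the unit interval inside the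
  type of points, and \<open>M\<close> is pushed forward to it.\<close>

lemma unit_interval_point_space:
  fixes M :: "real measure"
  assumes M: "real_distribution M" and M01: "AE t in M. t \<in> {0..1}"
  obtains \<Omega> :: "point set" and d :: "point \<Rightarrow> point \<Rightarrow> real" and \<nu> :: "point measure"
  where "compact_metric_space \<Omega> d" "borel_probability \<Omega> d \<nu>"
    "(\<lambda>\<omega>. \<omega> 0) \<in> borel_measurable \<nu>" "distr \<nu> borel (\<lambda>\<omega>. \<omega> 0) = M"
proof -
  interpret M: real_distribution M by fact
  \<comment> \<open>Clamping makes \<open>\<kappa>\<close> continuous from the whole line into the
    copy; as \<open>M\<close> is concentrated on [0, 1], it changes values only on a null
    set.\<close>
  define \<kappa> :: "real \<Rightarrow> point" where "\<kappa> t = (\<lambda>_. max 0 (min 1 t))" for t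
  define \<Omega> where "\<Omega> = range \<kappa>"
  \<comment> \<open>A metric on \<open>\<Omega>\<close> because constant sequences are determined by
    their value at 0.\<close>
  define d :: "point \<Rightarrow> point \<Rightarrow> real" where "d \<omega> \<eta> = \<bar>\<omega> 0 - \<eta> 0\<bar>" for \<omega> \<eta>
  interpret \<Omega>: Metric_space \<Omega> d
  proof
    show "d x y = 0 \<longleftrightarrow> x = y" if "x \<in> \<Omega>" "y \<in> \<Omega>" for x y
    proof -
      obtain s t where "x = \<kappa> s" "y = \<kappa> t" using \<open>x \<in> \<Omega>\<close> \<open>y \<in> \<Omega>\<close> by (auto simp: \<Omega>_def)
      then show ?thesis by (simp add: d_def \<kappa>_def fun_eq_iff)
    qed
  qed (auto simp: d_def)
  have \<kappa>_dist: "d (\<kappa> s) (\<kappa> t) \<le> dist s t" for s t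
    by (auto simp: d_def \<kappa>_def dist_real_def max_def min_def)
  have cont: "continuous_map euclidean \<Omega>.mtopology \<kappa>"
    unfolding \<Omega>.continuous_map_to_metric
  proof (intro ballI allI impI)
    fix t and r :: real
    assume "0 < r"
    have "\<kappa> s \<in> \<Omega>.mball (\<kappa> t) r" if "s \<in> ball t r" for s
      using \<kappa>_dist[of t s] that range_eqI[of _ \<kappa>] unfolding \<Omega>.in_mball by (auto simp: \<Omega>_def)
    then show "\<exists>U. openin euclidean U \<and> t \<in> U \<and> (\<forall>s\<in>U. \<kappa> s \<in> \<Omega>.mball (\<kappa> t) r)"
      using \<open>0 < r\<close> by (intro exI[of _ "ball t r"]) auto
  qed
  have "\<kappa> ` {0..1} = \<Omega>"
  proof
    have "\<kappa> t = \<kappa> (max 0 (min 1 t))" for t by (auto simp: \<kappa>_def)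
    moreover have "max 0 (min 1 t) \<in> {0..1}" for t :: real by auto
    ultimately show "\<Omega> \<subseteq> \<kappa> ` {0..1}" unfolding \<Omega>_def by blast
  qed (auto simp: \<Omega>_def)
  then have "compactin \<Omega>.mtopology \<Omega>"
    using image_compactin[OF _ cont, of "{0..1}"] by (simp add: compact_Icc)
  then have cms: "compact_metric_space \<Omega> d"
    unfolding compact_metric_space_def compact_space_def
    using \<Omega>.Metric_space_axioms by simp
  define \<Sigma> where "\<Sigma> = sigma \<Omega> {S. openin \<Omega>.mtopology S}"
  have sub: "{S. openin \<Omega>.mtopology S} \<subseteq> Pow \<Omega>"
    using openin_subset[of \<Omega>.mtopology] by auto
  have space_\<Sigma>: "space \<Sigma> = \<Omega>" and sets_\<Sigma>: "sets \<Sigma> = sigma_sets \<Omega> {S. openin \<Omega>.mtopology S}"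
    using sub by (simp_all add: \<Sigma>_def)
  have \<kappa>_meas: "\<kappa> \<in> measurable borel \<Sigma>"
    unfolding \<Sigma>_def
  proof (rule measurable_measure_of[OF sub])
    fix S assume "S \<in> {S. openin \<Omega>.mtopology S}"
    then have "openin euclidean {t \<in> topspace euclidean. \<kappa> t \<in> S}"
      using cont by (intro openin_continuous_map_preimage) auto
    then have "open (\<kappa> -` S)" by (simp add: vimage_def)
    then show "\<kappa> -` S \<inter> space borel \<in> sets borel" by simp
  qed (simp add: \<Omega>_def)
  then have \<kappa>_M: "\<kappa> \<in> measurable M \<Sigma>" by simp
  define \<nu> where "\<nu> = distr M \<Sigma> \<kappa>"
  have bp: "borel_probability \<Omega> d \<nu>"
    unfolding borel_probability_def \<nu>_def
    using M.prob_space_distr[OF \<kappa>_M] by (simp add: space_\<Sigma> sets_\<Sigma>)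
  have ev_\<Sigma>: "(\<lambda>\<omega>. \<omega> 0) \<in> borel_measurable \<Sigma>"
  proof (rule borel_measurableI)
    fix S :: "real set" assume S: "open S"
    have "openin \<Omega>.mtopology ((\<lambda>\<omega>. \<omega> 0) -` S \<inter> \<Omega>)"
      unfolding \<Omega>.openin_mtopology
    proof (intro conjI allI impI)
      fix \<omega> assume "\<omega> \<in> (\<lambda>\<omega>. \<omega> 0) -` S \<inter> \<Omega>"
      then obtain r where "0 < r" "\<And>y. dist y (\<omega> 0) < r \<Longrightarrow> y \<in> S"
        using S unfolding open_dist by auto
      then show "\<exists>r>0. \<Omega>.mball \<omega> r \<subseteq> (\<lambda>\<omega>. \<omega> 0) -` S \<inter> \<Omega>"
        by (intro exI[of _ r]) (auto simp: d_def dist_real_def abs_minus_commute)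
    qed simp
    then show "(\<lambda>\<omega>. \<omega> 0) -` S \<inter> space \<Sigma> \<in> sets \<Sigma>"
      by (simp add: space_\<Sigma> sets_\<Sigma> sigma_sets.Basic)
  qed
  then have ev: "(\<lambda>\<omega>. \<omega> 0) \<in> borel_measurable \<nu>" by (simp add: \<nu>_def)
  have "distr \<nu> borel (\<lambda>\<omega>. \<omega> 0) = distr M borel (\<lambda>t. \<kappa> t 0)"
    unfolding \<nu>_def by (subst distr_distr[OF ev_\<Sigma> \<kappa>_M]) (simp add: comp_def)
  also have "\<dots> = distr M borel (\<lambda>t. t)"
    by (rule distr_cong_AE) (use M01 in \<open>auto simp: \<kappa>_def\<close>)
  also have "\<dots> = M" by (rule distr_id2) simp
  finally have "distr \<nu> borel (\<lambda>\<omega>. \<omega> 0) = M" .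
  with cms bp ev show thesis by (rule that)
qed

text \<open>Everything is pulled back along evaluation at 0, whose law is \<open>M\<close>;
  conditions on \<open>u\<close> up to null sets become identities between classes.\<close>

lemma L2_model_on_points:
  fixes smul :: "'k::rc_scalar \<Rightarrow> 'h::real_normed_vector \<Rightarrow> 'h" and u :: "'h \<Rightarrow> real \<Rightarrow> 'k"
  assumes M: "real_distribution M" "AE t in M. t \<in> {0..1}"
    and m [measurable]: "m \<in> borel_measurable borel"
    and u: "\<And>x. u x \<in> square_integrable M"
    and u_add: "\<And>x y. AE t in M. u (x + y) t = u x t + u y t"
    and u_smul: "\<And>c x. AE t in M. u (smul c x) t = c * u x t"
    and u_norm: "\<And>x. (\<integral>t. (norm (u x t))\<^sup>2 \<partial>M) = (norm x)\<^sup>2"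
    and u_A: "\<And>x. x \<in> D \<Longrightarrow> AE t in M. of_real (m t) * u x t = u (A x) t"
  shows "\<exists>(\<Omega> :: point set) (d :: point \<Rightarrow> point \<Rightarrow> real) (\<mu> :: point measure)
           (m :: point \<Rightarrow> real) (U :: 'h \<Rightarrow> (point \<Rightarrow> 'k) set).
      compact_metric_space \<Omega> d \<and>
      borel_probability \<Omega> d \<mu> \<and>
      m \<in> borel_measurable \<mu> \<and>
      L2_self_adjoint \<mu> (mult_dom \<mu> m :: (point \<Rightarrow> 'k) set set) (mult_op \<mu> m) \<and>
      isometry_into_L2 smul \<mu> U \<and>
      (\<forall>x\<in>D. U x \<in> mult_dom \<mu> m \<and> mult_op \<mu> m (U x) = U (A x))"
proof -
  from unit_interval_point_space[OF M]
  obtain \<Omega> d and \<nu> :: "point measure" where cms: "compact_metric_space \<Omega> d"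
    and bp: "borel_probability \<Omega> d \<nu>" and ev [measurable]: "(\<lambda>\<omega>. \<omega> 0) \<in> borel_measurable \<nu>"
    and distr: "distr \<nu> borel (\<lambda>\<omega>. \<omega> 0) = M" .
  interpret M: real_distribution M by fact
  have AE_\<nu>: "AE \<omega> in \<nu>. P (\<omega> 0)" if "AE t in M. P t" for P
    using that unfolding distr[symmetric] by (rule AE_distrD[OF ev])
  have [measurable]: "u x \<in> borel_measurable borel" for x
    using square_integrableD(1)[OF u[of x]] by simp
  define u' where "u' x \<omega> = u x (\<omega> 0)" for x and \<omega> :: point
  define m' where "m' \<omega> = m (\<omega> 0)" for \<omega> :: point
  have [measurable]: "m' \<in> borel_measurable \<nu>" unfolding m'_def by measurable
  have u'm [measurable]: "u' x \<in> borel_measurable \<nu>" for x unfolding u'_def by measurable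
  have u': "u' x \<in> square_integrable \<nu>" for x
  proof -
    have "integrable (distr \<nu> borel (\<lambda>\<omega>. \<omega> 0)) (\<lambda>t. (norm (u x t))\<^sup>2)"
      unfolding distr by (rule square_integrableD[OF u])
    then have "integrable \<nu> (\<lambda>\<omega>. (norm (u' x \<omega>))\<^sup>2)"
      unfolding u'_def by (rule integrable_distr[OF ev])
    then show ?thesis by (simp add: square_integrable_def)
  qed
  have rep: "AE \<omega> in \<nu>. L2_rep (L2_class \<nu> (u' x)) \<omega> = u' x \<omega>" for x
    by (rule AE_L2_rep_class[OF u'])
  have rep_sq: "L2_rep (L2_class \<nu> (u' x)) \<in> square_integrable \<nu>" for x
    by (intro L2_rep_square_integrable L2_class_in_L2 u')
  define U where "U x = L2_class \<nu> (u' x)" for x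
  have "isometry_into_L2 smul \<nu> U"
    unfolding isometry_into_L2_def
  proof (intro conjI allI)
    fix x y c
    show "U x \<in> L2 \<nu>" unfolding U_def by (intro L2_class_in_L2 u')
    show "U (x + y) = L2_add \<nu> (U x) (U y)"
      unfolding U_def L2_add_def
    proof (rule L2_class_cong[OF u' square_integrable_add[OF rep_sq rep_sq]])
      show "AE \<omega> in \<nu>. u' (x + y) \<omega> = L2_rep (L2_class \<nu> (u' x)) \<omega> + L2_rep (L2_class \<nu> (u' y)) \<omega>"
        using AE_\<nu>[OF u_add[of x y]] rep[of x] rep[of y] by eventually_elim (simp add: u'_def)
    qed
    show "U (smul c x) = L2_scale \<nu> c (U x)"
      unfolding U_def L2_scale_def
    proof (rule L2_class_cong[OF u' square_integrable_cmult[OF rep_sq]])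
      show "AE \<omega> in \<nu>. u' (smul c x) \<omega> = c * L2_rep (L2_class \<nu> (u' x)) \<omega>"
        using AE_\<nu>[OF u_smul[of c x]] rep[of x] by eventually_elim (simp add: u'_def)
    qed
    have "(\<integral>t. (norm (u x t))\<^sup>2 \<partial>distr \<nu> borel (\<lambda>\<omega>. \<omega> 0)) = (\<integral>\<omega>. (norm (u' x \<omega>))\<^sup>2 \<partial>\<nu>)"
      unfolding u'_def by (rule integral_distr[OF ev]) measurable
    then show "L2_norm \<nu> (U x) = norm x"
      unfolding U_def L2_norm_class[OF u'] distr u_norm by (metis norm_ge_zero real_sqrt_abs abs_of_nonneg)
  qed
  moreover have "U x \<in> mult_dom \<nu> m' \<and> mult_op \<nu> m' (U x) = U (A x)" if x: "x \<in> D" for x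
  proof -
    have AE: "AE \<omega> in \<nu>. of_real (m' \<omega>) * u' x \<omega> = u' (A x) \<omega>"
      using AE_\<nu>[OF u_A[OF x]] by (simp add: u'_def m'_def)
    \<comment> \<open>The product is square-integrable because it agrees almost everywhere with
      \<open>u' (A x)\<close>, which is.\<close>
    have s: "(\<lambda>\<omega>. of_real (m' \<omega>) * u' x \<omega>) \<in> square_integrable \<nu>"
      by (rule square_integrable_cong_AE[OF u' _ AE]) measurable
    show ?thesis
      unfolding U_def using L2_class_in_mult_dom[OF _ u' s] L2_class_cong[OF s u' AE] by simp
  qed
  moreover have "L2_self_adjoint \<nu> (mult_dom \<nu> m' :: (point \<Rightarrow> 'k) set set) (mult_op \<nu> m')"
    by (rule L2_self_adjoint_mult_op) measurable
  moreover have "m' \<in> borel_measurable \<nu>" by measurable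
  ultimately show ?thesis using cms bp by blast
qed

theorem theorem1p1:
  fixes smul :: "'k::rc_scalar \<Rightarrow> 'h::banach \<Rightarrow> 'h"
    and ip :: "'h \<Rightarrow> 'h \<Rightarrow> 'k"
    and D :: "'h set"
    and A :: "'h \<Rightarrow> 'h"
  assumes "rc_hilbert smul ip"
    and "separable_space (euclidean :: 'h topology)"
    and "infinite_dimensional smul"
    and "linear_operator smul D A"
    and "densely_defined D"
    and "symmetric_operator ip D A"
  shows "\<exists>(\<Omega> :: point set) (d :: point \<Rightarrow> point \<Rightarrow> real) (\<mu> :: point measure)
           (m :: point \<Rightarrow> real) (U :: 'h \<Rightarrow> (point \<Rightarrow> 'k) set).
      compact_metric_space \<Omega> d \<and>
      borel_probability \<Omega> d \<mu> \<and>
      m \<in> borel_measurable \<mu> \<and>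
      L2_self_adjoint \<mu> (mult_dom \<mu> m :: (point \<Rightarrow> 'k) set set) (mult_op \<mu> m) \<and>
      isometry_into_L2 smul \<mu> U \<and>
      (\<forall>x\<in>D. U x \<in> mult_dom \<mu> m \<and> mult_op \<mu> m (U x) = U (A x))"
proof -
  interpret H: rc_hilbert smul ip by fact
  \<comment> \<open>The real part induces the same norm, and \<open>A\<close> stays symmetric with
    respect to it.\<close>
  define B where "B x y = Re (to_complex (ip x y))" for x y
  interpret B: real_inner_form B
  proof
    fix x y z r
    show "B (x + y) z = B x z + B y z"
      by (simp add: B_def H.ip_add_left to_complex_add)
    show "B (r *\<^sub>R x) y = r * B x y"
      by (simp add: B_def H.smul_of_real[symmetric] H.ip_smul_left to_complex_mult)
    show "B x y = B y x"
      unfolding B_def by (subst H.ip_commute) (simp add: to_complex_rc_cnj)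
    show "B x x = (norm x)\<^sup>2"
      by (simp only: B_def H.ip_self to_complex_of_real Re_complex_of_real)
  qed
  have sub: "H.subspace D" and add: "\<And>x y. x \<in> D \<Longrightarrow> y \<in> D \<Longrightarrow> A (x + y) = A x + A y"
    and smul: "\<And>c x. x \<in> D \<Longrightarrow> A (smul c x) = smul c (A x)"
    using assms(4) by (auto simp: linear_operator_def)
  have sub_real: "subspace D"
    using sub H.subspace_0[OF sub] H.subspace_add[OF sub] H.subspace_scale[OF sub]
    unfolding real_vector.subspace_def by (simp flip: H.smul_of_real)
  have scale: "\<And>x r. x \<in> D \<Longrightarrow> A (r *\<^sub>R x) = r *\<^sub>R A x"
    using smul by (simp flip: H.smul_of_real)
  have sym: "B (A x) y = B x (A y)" if "x \<in> D" "y \<in> D" for x y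
    using assms(6) that by (simp add: symmetric_operator_def B_def)
  have dense: "closure D = UNIV" using assms(5) by (simp add: densely_defined_def)
  obtain M :: "real measure" and m and F :: "'h \<Rightarrow> real \<Rightarrow> real"
    where M: "real_distribution M" "AE t in M. t \<in> {0..1}" and m: "m \<in> borel_measurable borel"
      and F: "\<And>x. F x \<in> square_integrable M" and FB: "\<And>x y. (\<integral>t. F x t * F y t \<partial>M) = B x y"
      and FA: "\<And>x. x \<in> D \<Longrightarrow> AE t in M. m t * F x t = F (A x) t"
    by (rule B.multiplication_model[OF assms(2) sub_real dense add scale sym]) blast+
  have F_norm: "(\<integral>t. (F x t)\<^sup>2 \<partial>M) = (norm x)\<^sup>2" for x
    using FB[of x x] by (simp add: B.self power2_eq_square)
  \<comment> \<open>\<open>F\<close> is known only through inner products; these force the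
    difference of the two sides to have norm 0.\<close>
  have F_add: "AE t in M. F (x + y) t = F x t + F y t" for x y
  proof (rule AE_eq_of_integral_square_diff[OF F square_integrable_add[OF F F]])
    note i = square_integrable_mult[OF F F]
    show "(\<integral>t. F (x + y) t * F (x + y) t \<partial>M) - 2 * (\<integral>t. F (x + y) t * (F x t + F y t) \<partial>M)
        + (\<integral>t. (F x t + F y t) * (F x t + F y t) \<partial>M) = 0"
      by (simp add: distrib_left distrib_right i FB B.add_left B.add_right B.commute[of y x])
  qed
  have F_scale: "AE t in M. F (r *\<^sub>R x) t = r * F x t" for r x
  proof (rule AE_eq_of_integral_square_diff[OF F square_integrable_cmult[OF F]])
    have "F (r *\<^sub>R x) t * (r * F x t) = r * (F (r *\<^sub>R x) t * F x t)"
      "r * F x t * (r * F x t) = r * (r * (F x t * F x t))" for t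
      by simp_all
    then show "(\<integral>t. F (r *\<^sub>R x) t * F (r *\<^sub>R x) t \<partial>M) - 2 * (\<integral>t. F (r *\<^sub>R x) t * (r * F x t) \<partial>M)
        + (\<integral>t. r * F x t * (r * F x t) \<partial>M) = 0"
      by (simp only: integral_mult_right_zero FB B.scale_left B.scale_right)
  qed
  have of_real_F: "(\<lambda>t. of_real (F x t) :: 'k) \<in> square_integrable M" for x
    using square_integrableD[OF F[of x]] by (simp add: square_integrable_def)
  from range_to_complex[where 'a = 'k] show ?thesis
  proof
    assume R: "range (to_complex :: 'k \<Rightarrow> complex) = \<real>"
    \<comment> \<open>Every scalar is real here, so real linearity of \<open>F\<close> is already
      linearity over K.\<close>
    have of_real: "\<exists>r. c = of_real r" for c :: 'k
    proof -
      have "to_complex c \<in> \<real>" using R by blast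
      then obtain r where r: "to_complex c = of_real r" by (auto elim: Reals_cases)
      have "c = of_real r" by (rule to_complex_eqI) (simp add: r)
      then show ?thesis ..
    qed
    show ?thesis
    proof (rule L2_model_on_points[where u = "\<lambda>x t. of_real (F x t)", OF M m of_real_F])
      show "AE t in M. of_real (F (x + y) t) = (of_real (F x t) + of_real (F y t) :: 'k)" for x y
        using F_add[of x y] by eventually_elim simp
      show "AE t in M. of_real (F (smul c x) t) = c * of_real (F x t)" for c x
      proof -
        obtain r where c: "c = of_real r" using of_real by blast
        show ?thesis using F_scale[of r x] unfolding c H.smul_of_real by eventually_elim simp
      qed
      show "(\<integral>t. (norm (of_real (F x t) :: 'k))\<^sup>2 \<partial>M) = (norm x)\<^sup>2" for x
        by (simp add: F_norm)
      show "AE t in M. of_real (m t) * of_real (F x t) = (of_real (F (A x) t) :: 'k)" if "x \<in> D" for x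
        using FA[OF that] by eventually_elim (metis of_real_mult)
    qed
  next
    assume "range (to_complex :: 'k \<Rightarrow> complex) = UNIV"
    then obtain j :: 'k where j: "to_complex j = \<i>" by (metis surjD)
    have jj: "j * j = -1"
      by (rule to_complex_eqI) (simp add: to_complex_mult to_complex_minus to_complex_one j)
    have decomp: "\<exists>a b. c = of_real a + of_real b * j" for c :: 'k
      by (rule exI[of _ "Re (to_complex c)"], rule exI[of _ "Im (to_complex c)"])
        (rule to_complex_eqI, simp add: to_complex_add to_complex_mult j complex_eq mult.commute)
    have norm2: "(norm (of_real a - j * of_real b :: 'k))\<^sup>2 = a\<^sup>2 + b\<^sup>2" for a b
    proof -
      have "(norm (of_real a - j * of_real b))\<^sup>2 = (norm (to_complex (of_real a - j * of_real b)))\<^sup>2"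
        by (simp only: norm_to_complex)
      also have "\<dots> = a\<^sup>2 + b\<^sup>2"
        by (simp add: to_complex_diff to_complex_mult j cmod_power2)
      finally show ?thesis .
    qed
    have norm_j: "norm (smul j x) = norm x" for x
    proof -
      have "ip (smul j x) (smul j x) = j * rc_cnj j * ip x x"
        by (metis H.ip_commute H.ip_smul_left mult.assoc mult.left_commute rc_cnj_mult)
      also have "j * rc_cnj j = 1"
        by (rule to_complex_eqI) (simp add: to_complex_mult to_complex_rc_cnj to_complex_one j)
      finally have "(of_real ((norm (smul j x))\<^sup>2) :: 'k) = of_real ((norm x)\<^sup>2)"
        unfolding H.ip_self by simp
      then have "(norm (smul j x))\<^sup>2 = (norm x)\<^sup>2" by (rule of_real_eq_iff[THEN iffD1])
      then show ?thesis by simp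
    qed
    \<comment> \<open>\<open>F x\<close> and \<open>F (smul j x)\<close> both have norm
      \<open>norm x\<close> and their squares add up by \<open>norm2\<close>; this factor
      compensates the resulting 2.\<close>
    define s :: 'k where "s = of_real (1 / sqrt 2)"
    \<comment> \<open>The complex-linear part of \<open>F\<close>, up to normalisation: putting
      \<open>smul j x\<close> for \<open>x\<close> turns the bracket into
      \<open>F (smul j x) + j * F x\<close>, which is \<open>j\<close> times the bracket.\<close>
    define u where "u x t = s * (of_real (F x t) - j * of_real (F (smul j x) t))" for x t
    have u: "u x \<in> square_integrable M" for x
      unfolding u_def by (intro square_integrable_cmult square_integrable_diff of_real_F)
    have u_add: "AE t in M. u (x + y) t = u x t + u y t" for x y
      using F_add[of x y] F_add[of "smul j x" "smul j y"]
      by eventually_elim (simp add: u_def H.scale_right_distrib algebra_simps)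
    have u_real: "AE t in M. u (r *\<^sub>R x) t = of_real r * u x t" for r x
    proof -
      have eq: "smul j (r *\<^sub>R x) = r *\<^sub>R smul j x"
        by (simp flip: H.smul_of_real add: mult.commute)
      show ?thesis
        using F_scale[of r x] F_scale[of r "smul j x"]
        unfolding u_def eq by eventually_elim (simp add: algebra_simps)
    qed
    have u_j: "AE t in M. u (smul j x) t = j * u x t" for x
    proof -
      have eq: "smul j (smul j x) = (-1) *\<^sub>R x"
        using H.smul_of_real[of "-1" x] by (simp add: jj)
      from F_scale[of "-1" x] show ?thesis
      proof eventually_elim
        case (elim t)
        have "j * u x t = s * (j * of_real (F x t) - (j * j) * of_real (F (smul j x) t))"
          by (simp add: u_def algebra_simps)
        then show ?case unfolding u_def eq elim by (simp add: jj algebra_simps)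
      qed
    qed
    show ?thesis
    proof (rule L2_model_on_points[OF M m u u_add])
      show "AE t in M. u (smul c x) t = c * u x t" for c x
      proof -
        obtain a b where c: "c = of_real a + of_real b * j" using decomp by blast
        have eq: "smul c x = a *\<^sub>R x + b *\<^sub>R smul j x"
          by (simp add: c H.scale_left_distrib flip: H.smul_of_real)
        show ?thesis
          unfolding eq using u_add[of "a *\<^sub>R x" "b *\<^sub>R smul j x"] u_real[of a x] u_real[of b "smul j x"] u_j[of x]
          by eventually_elim (simp add: c algebra_simps)
      qed
      show "(\<integral>t. (norm (u x t))\<^sup>2 \<partial>M) = (norm x)\<^sup>2" for x
      proof -
        have norm_s: "(norm s)\<^sup>2 = 1/2" unfolding s_def norm_of_real by (simp add: power_divide)
        have "(\<integral>t. (norm (u x t))\<^sup>2 \<partial>M) = (\<integral>t. (1/2) * (F x t)\<^sup>2 + (1/2) * (F (smul j x) t)\<^sup>2 \<partial>M)"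
          by (simp only: u_def norm_mult power_mult_distrib norm2 norm_s distrib_left)
        also have "\<dots> = (norm x)\<^sup>2"
          using square_integrable_real_square[OF F] by (simp add: F_norm norm_j)
        finally show ?thesis .
      qed
      show "AE t in M. of_real (m t) * u x t = u (A x) t" if x: "x \<in> D" for x
      proof -
        \<comment> \<open>\<open>A\<close> commutes with \<open>smul j\<close> and \<open>m\<close>
          is real, so the relations for \<open>F\<close> at \<open>x\<close> and at
          \<open>smul j x\<close> combine to the one for \<open>u\<close>.\<close>
        have "smul j x \<in> D" using H.subspace_scale[OF sub x] .
        from FA[OF x] FA[OF this] show ?thesis
        proof eventually_elim
          case (elim t)
          have "of_real (m t) * u x t = s * (of_real (m t * F x t) - j * of_real (m t * F (smul j x) t))"
            by (simp add: u_def algebra_simps)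
          then show ?case using elim by (simp add: u_def smul[OF x])
        qed
      qed
    qed
  qed
qed

end
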